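(* Let $n\ge 1$. The category $\mathcal A_n$ of multisets of intervals of type $n$ is abelian. The direct sum of objects is given by the disjoint union of multisets, and the full subcategory of indecomposable objects of $\mathcal A_n$ identifies with the category $\mathcal I_n$ of intervals of type $n$. Every object of $\mathcal A_n$ admits a finite composition series, and the composition length of an interval of length $l$ equals $l+1$.
   Context: An interval of length $l$ is a pair of integers $a\le b$ with $b-a=l$, written $[a,b]$. $\mathbb F_2$ is the field with two elements; a category is $\mathbb F_2$-linear if its morphism sets are $\mathbb F_2$-vector spaces and composition is bilinear. The $\mathbb F_2$-linear category $\mathcal I_n$ of intervals of type $n$: the objects are the $[a,b]\in\mathbb Z\times\mathbb Z$ with $1\le a\le b\le n$. For $x=[a,b]$, $y=[c,d]$ set $\operatorname{Hom}_{\mathcal I_n}(x,y)=\mathbb F_2$ if $a\le c\le b\le d$, and $\operatorname{Hom}_{\mathcal I_n}(x,y)=\{0\}$ otherwise. When $\operatorname{Hom}_{\mathcal I_n}(x,y)\neq 0$ write $\alpha_{xy}$ for the non-zero morphism $x\to y$. Composition is determined by two rules: $\alpha_{yz}\circ\alpha_{xy}=\alpha_{xz}$ when $x=[a,b]$, $y=[c,d]$, $z=[e,f]$ and $a\le c\le e\le b\le d\le f$; and $\psi\circ\phi=0$ for any other pair of morphisms $\phi\colon x\to y$, $\psi\colon y\to z$. The category $\mathcal A_n$ of multisets of intervals of type $n$: the objects are the finite multisets $\oplus_{i=1}^r x_i:=\{x_1,\ldots,x_r\}$ of objects $x_i$ of $\mathcal I_n$ (the empty multiset, $r=0$, is allowed).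 The morphism sets are $\operatorname{Hom}_{\mathcal A_n}(\oplus_i x_i,\oplus_j y_j):=\bigoplus_{i,j}\operatorname{Hom}_{\mathcal I_n}(x_i,y_j)$, and composition is matrix multiplication: $(\psi_{jk})\circ(\phi_{ij}):=\left(\sum_j\psi_{jk}\circ\phi_{ij}\right)$. An interval $x$ is regarded as the one-element multiset $\{x\}$. *)

theory Defs
  imports Complex_Main "HOL-Library.Multiset" "HOL-Library.Z2" "HOL-Library.Function_Algebras"
begin

section \<open>Categories\<close>

text \<open>
  The morphism sets \<open>Hom C x y\<close> are not required to be disjoint: a morphism always comes with
  its source and target, and composition takes the three objects involved as arguments.
  \<open>Comp C x y z g f\<close> is the composite of \<open>f : x \<rightarrow> y\<close> and \<open>g : y \<rightarrow> z\<close>.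
\<close>

record ('o, 'm) cat =
  Ob :: "'o set"
  Hom :: "'o \<Rightarrow> 'o \<Rightarrow> 'm set"
  Ident :: "'o \<Rightarrow> 'm"
  Comp :: "'o \<Rightarrow> 'o \<Rightarrow> 'o \<Rightarrow> 'm \<Rightarrow> 'm \<Rightarrow> 'm"

locale category =
  fixes C :: "('o, 'm) cat"
  assumes Ident_in_Hom: "x \<in> Ob C \<Longrightarrow> Ident C x \<in> Hom C x x"
    and Comp_in_Hom:
      "\<lbrakk>x \<in> Ob C; y \<in> Ob C; z \<in> Ob C; f \<in> Hom C x y; g \<in> Hom C y z\<rbrakk>
        \<Longrightarrow> Comp C x y z g f \<in> Hom C x z"
    and Comp_Ident_right:
      "\<lbrakk>x \<in> Ob C; y \<in> Ob C; f \<in> Hom C x y\<rbrakk> \<Longrightarrow> Comp C x x y f (Ident C x) = f"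
    and Comp_Ident_left:
      "\<lbrakk>x \<in> Ob C; y \<in> Ob C; f \<in> Hom C x y\<rbrakk> \<Longrightarrow> Comp C x y y (Ident C y) f = f"
    and Comp_assoc:
      "\<lbrakk>w \<in> Ob C; x \<in> Ob C; y \<in> Ob C; z \<in> Ob C;
        f \<in> Hom C w x; g \<in> Hom C x y; h \<in> Hom C y z\<rbrakk>
        \<Longrightarrow> Comp C w x z (Comp C x y z h g) f = Comp C w y z h (Comp C w x y g f)"

definition full_subcategory :: "('o, 'm) cat \<Rightarrow> ('o \<Rightarrow> bool) \<Rightarrow> ('o, 'm) cat" where
  "full_subcategory C P = C\<lparr>Ob := {x \<in> Ob C. P x}\<rparr>"

definition is_iso :: "('o, 'm) cat \<Rightarrow> 'o \<Rightarrow> 'o \<Rightarrow> 'm \<Rightarrow> bool" where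
  "is_iso C x y f \<longleftrightarrow> f \<in> Hom C x y \<and>
    (\<exists>g \<in> Hom C y x. Comp C x y x g f = Ident C x \<and> Comp C y x y f g = Ident C y)"

definition is_monic :: "('o, 'm) cat \<Rightarrow> 'o \<Rightarrow> 'o \<Rightarrow> 'm \<Rightarrow> bool" where
  "is_monic C x y f \<longleftrightarrow> f \<in> Hom C x y \<and>
    (\<forall>w \<in> Ob C. \<forall>g \<in> Hom C w x. \<forall>h \<in> Hom C w x.
      Comp C w x y f g = Comp C w x y f h \<longrightarrow> g = h)"

definition is_epic :: "('o, 'm) cat \<Rightarrow> 'o \<Rightarrow> 'o \<Rightarrow> 'm \<Rightarrow> bool" where
  "is_epic C x y f \<longleftrightarrow> f \<in> Hom C x y \<and>
    (\<forall>z \<in> Ob C. \<forall>g \<in> Hom C y z. \<forall>h \<in> Hom C y z.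
      Comp C x y z g f = Comp C x y z h f \<longrightarrow> g = h)"

definition zero_object :: "('o, 'm) cat \<Rightarrow> 'o \<Rightarrow> bool" where
  "zero_object C z \<longleftrightarrow> z \<in> Ob C \<and>
    (\<forall>x \<in> Ob C. (\<exists>!f. f \<in> Hom C x z) \<and> (\<exists>!f. f \<in> Hom C z x))"


section \<open>Abelian and linear categories\<close>

text \<open>The additive structure on the morphism sets is inherited from the type of morphisms.\<close>

locale preadditive_category = category C
  for C :: "('o, 'm::ab_group_add) cat" +
  assumes zero_in_Hom: "\<lbrakk>x \<in> Ob C; y \<in> Ob C\<rbrakk> \<Longrightarrow> 0 \<in> Hom C x y"
    and add_in_Hom:
      "\<lbrakk>x \<in> Ob C; y \<in> Ob C; f \<in> Hom C x y; g \<in> Hom C x y\<rbrakk> \<Longrightarrow> f + g \<in> Hom C x y"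
    and uminus_in_Hom:
      "\<lbrakk>x \<in> Ob C; y \<in> Ob C; f \<in> Hom C x y\<rbrakk> \<Longrightarrow> - f \<in> Hom C x y"
    and Comp_add_left:
      "\<lbrakk>x \<in> Ob C; y \<in> Ob C; z \<in> Ob C; f \<in> Hom C x y; g \<in> Hom C y z; g' \<in> Hom C y z\<rbrakk>
        \<Longrightarrow> Comp C x y z (g + g') f = Comp C x y z g f + Comp C x y z g' f"
    and Comp_add_right:
      "\<lbrakk>x \<in> Ob C; y \<in> Ob C; z \<in> Ob C; f \<in> Hom C x y; f' \<in> Hom C x y; g \<in> Hom C y z\<rbrakk>
        \<Longrightarrow> Comp C x y z g (f + f') = Comp C x y z g f + Comp C x y z g f'"

definition is_kernel ::
    "('o, 'm::ab_group_add) cat \<Rightarrow> 'o \<Rightarrow> 'o \<Rightarrow> 'm \<Rightarrow> 'o \<Rightarrow> 'm \<Rightarrow> bool" where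
  "is_kernel C x y f K k \<longleftrightarrow> K \<in> Ob C \<and> k \<in> Hom C K x \<and> Comp C K x y f k = 0 \<and>
    (\<forall>w \<in> Ob C. \<forall>g \<in> Hom C w x. Comp C w x y f g = 0 \<longrightarrow>
      (\<exists>!h. h \<in> Hom C w K \<and> Comp C w K x k h = g))"

definition is_cokernel ::
    "('o, 'm::ab_group_add) cat \<Rightarrow> 'o \<Rightarrow> 'o \<Rightarrow> 'm \<Rightarrow> 'o \<Rightarrow> 'm \<Rightarrow> bool" where
  "is_cokernel C x y f Q q \<longleftrightarrow> Q \<in> Ob C \<and> q \<in> Hom C y Q \<and> Comp C x y Q q f = 0 \<and>
    (\<forall>w \<in> Ob C. \<forall>g \<in> Hom C y w. Comp C x y w g f = 0 \<longrightarrow>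
      (\<exists>!h. h \<in> Hom C Q w \<and> Comp C y Q w h q = g))"

text \<open>\<open>S\<close> is a direct sum (biproduct) of \<open>x\<close> and \<open>y\<close>.\<close>

definition is_direct_sum :: "('o, 'm::ab_group_add) cat \<Rightarrow> 'o \<Rightarrow> 'o \<Rightarrow> 'o \<Rightarrow> bool" where
  "is_direct_sum C x y S \<longleftrightarrow> x \<in> Ob C \<and> y \<in> Ob C \<and> S \<in> Ob C \<and>
    (\<exists>i1 \<in> Hom C x S. \<exists>i2 \<in> Hom C y S. \<exists>p1 \<in> Hom C S x. \<exists>p2 \<in> Hom C S y.
      Comp C x S x p1 i1 = Ident C x \<and> Comp C y S y p2 i2 = Ident C y \<and>
      Comp C y S x p1 i2 = 0 \<and> Comp C x S y p2 i1 = 0 \<and>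
      Comp C S x S i1 p1 + Comp C S y S i2 p2 = Ident C S)"

locale abelian_category = preadditive_category C
  for C :: "('o, 'm::ab_group_add) cat" +
  assumes ex_zero_object: "\<exists>z. zero_object C z"
    and ex_direct_sum: "\<lbrakk>x \<in> Ob C; y \<in> Ob C\<rbrakk> \<Longrightarrow> \<exists>S. is_direct_sum C x y S"
    and ex_kernel:
      "\<lbrakk>x \<in> Ob C; y \<in> Ob C; f \<in> Hom C x y\<rbrakk> \<Longrightarrow> \<exists>K k. is_kernel C x y f K k"
    and ex_cokernel:
      "\<lbrakk>x \<in> Ob C; y \<in> Ob C; f \<in> Hom C x y\<rbrakk> \<Longrightarrow> \<exists>Q q. is_cokernel C x y f Q q"
    and monic_is_kernel:
      "\<lbrakk>x \<in> Ob C; y \<in> Ob C; is_monic C x y f\<rbrakk>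
        \<Longrightarrow> \<exists>z \<in> Ob C. \<exists>g \<in> Hom C y z. is_kernel C y z g x f"
    and epic_is_cokernel:
      "\<lbrakk>x \<in> Ob C; y \<in> Ob C; is_epic C x y f\<rbrakk>
        \<Longrightarrow> \<exists>w \<in> Ob C. \<exists>g \<in> Hom C w x. is_cokernel C w x g y f"

locale linear_category = preadditive_category C + vector_space scale
  for C :: "('o, 'm::ab_group_add) cat" and scale :: "'k::field \<Rightarrow> 'm \<Rightarrow> 'm" +
  assumes scale_in_Hom:
      "\<lbrakk>x \<in> Ob C; y \<in> Ob C; f \<in> Hom C x y\<rbrakk> \<Longrightarrow> scale c f \<in> Hom C x y"
    and Comp_scale_left:
      "\<lbrakk>x \<in> Ob C; y \<in> Ob C; z \<in> Ob C; f \<in> Hom C x y; g \<in> Hom C y z\<rbrakk>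
        \<Longrightarrow> Comp C x y z (scale c g) f = scale c (Comp C x y z g f)"
    and Comp_scale_right:
      "\<lbrakk>x \<in> Ob C; y \<in> Ob C; z \<in> Ob C; f \<in> Hom C x y; g \<in> Hom C y z\<rbrakk>
        \<Longrightarrow> Comp C x y z g (scale c f) = scale c (Comp C x y z g f)"

text \<open>An isomorphism of linear categories, given by \<open>F\<close> on objects and by
  \<open>\<Phi> x y : Hom x y \<rightarrow> Hom (F x) (F y)\<close> on morphisms.\<close>

locale linear_category_isomorphism =
  C: linear_category C scaleC + D: linear_category D scaleD
  for C :: "('o, 'm::ab_group_add) cat" and scaleC :: "'k::field \<Rightarrow> 'm \<Rightarrow> 'm"
    and D :: "('p, 'n::ab_group_add) cat" and scaleD :: "'k \<Rightarrow> 'n \<Rightarrow> 'n" +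
  fixes F :: "'o \<Rightarrow> 'p" and \<Phi> :: "'o \<Rightarrow> 'o \<Rightarrow> 'm \<Rightarrow> 'n"
  assumes bij_betw_Ob: "bij_betw F (Ob C) (Ob D)"
    and bij_betw_Hom:
      "\<lbrakk>x \<in> Ob C; y \<in> Ob C\<rbrakk> \<Longrightarrow> bij_betw (\<Phi> x y) (Hom C x y) (Hom D (F x) (F y))"
    and map_add:
      "\<lbrakk>x \<in> Ob C; y \<in> Ob C; f \<in> Hom C x y; g \<in> Hom C x y\<rbrakk>
        \<Longrightarrow> \<Phi> x y (f + g) = \<Phi> x y f + \<Phi> x y g"
    and map_scale:
      "\<lbrakk>x \<in> Ob C; y \<in> Ob C; f \<in> Hom C x y\<rbrakk> \<Longrightarrow> \<Phi> x y (scaleC c f) = scaleD c (\<Phi> x y f)"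
    and map_Ident: "x \<in> Ob C \<Longrightarrow> \<Phi> x x (Ident C x) = Ident D (F x)"
    and map_Comp:
      "\<lbrakk>x \<in> Ob C; y \<in> Ob C; z \<in> Ob C; f \<in> Hom C x y; g \<in> Hom C y z\<rbrakk>
        \<Longrightarrow> \<Phi> x z (Comp C x y z g f) = Comp D (F x) (F y) (F z) (\<Phi> y z g) (\<Phi> x y f)"


section \<open>Indecomposable objects, simple objects and composition series\<close>

definition indecomposable :: "('o, 'm::ab_group_add) cat \<Rightarrow> 'o \<Rightarrow> bool" where
  "indecomposable C x \<longleftrightarrow> x \<in> Ob C \<and> \<not> zero_object C x \<and>
    (\<forall>y z. is_direct_sum C y z x \<longrightarrow> zero_object C y \<or> zero_object C z)"

definition simple_object :: "('o, 'm) cat \<Rightarrow> 'o \<Rightarrow> bool" where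
  "simple_object C x \<longleftrightarrow> x \<in> Ob C \<and> \<not> zero_object C x \<and>
    (\<forall>y \<in> Ob C. \<forall>f. is_monic C y x f \<longrightarrow> zero_object C y \<or> is_iso C y x f)"

text \<open>
  A composition series \<open>0 = X 0 \<subset> X 1 \<subset> \<dots> \<subset> X k = x\<close> of length \<open>k\<close>: the inclusions are the
  monomorphisms \<open>m i : X i \<rightarrow> X (Suc i)\<close>, whose cokernels are required to be simple.  The
  subobject of \<open>x\<close> represented by \<open>X i\<close> is the composite of \<open>m i\<close>, \dots, \<open>m (k - 1)\<close>.
\<close>

definition composition_series ::
    "('o, 'm::ab_group_add) cat \<Rightarrow> 'o \<Rightarrow> nat \<Rightarrow> (nat \<Rightarrow> 'o) \<Rightarrow> (nat \<Rightarrow> 'm) \<Rightarrow> bool" where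
  "composition_series C x k X m \<longleftrightarrow>
    (\<forall>i \<le> k. X i \<in> Ob C) \<and> zero_object C (X 0) \<and> X k = x \<and>
    (\<forall>i < k. is_monic C (X i) (X (Suc i)) (m i) \<and>
      (\<exists>Q q. is_cokernel C (X i) (X (Suc i)) (m i) Q q \<and> simple_object C Q))"

text \<open>Independence of the chosen series is part of the notion of length.\<close>

definition has_composition_length :: "('o, 'm::ab_group_add) cat \<Rightarrow> 'o \<Rightarrow> nat \<Rightarrow> bool" where
  "has_composition_length C x k \<longleftrightarrow>
    (\<exists>X m. composition_series C x k X m) \<and>
    (\<forall>k' X m. composition_series C x k' X m \<longrightarrow> k' = k)"


section \<open>Intervals and multisets of intervals\<close>

text \<open>The pair \<open>(a, b)\<close> is the interval $[a,b]$; \<open>bit\<close> is the field with two elements.\<close>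

type_synonym interval = "int \<times> int"

fun interval_Hom :: "interval \<Rightarrow> interval \<Rightarrow> bit set" where
  "interval_Hom (a, b) (c, d) = (if a \<le> c \<and> c \<le> b \<and> b \<le> d then UNIV else {0})"

text \<open>The non-zero morphisms of intervals are the scalars \<open>1\<close>, and the product of \<open>\<psi>\<close> and \<open>\<phi>\<close> is non-zero
  only if both are.\<close>

fun interval_Comp :: "interval \<Rightarrow> interval \<Rightarrow> interval \<Rightarrow> bit \<Rightarrow> bit \<Rightarrow> bit" where
  "interval_Comp (a, b) (c, d) (e, f) \<psi> \<phi> =
    (if a \<le> c \<and> c \<le> e \<and> e \<le> b \<and> b \<le> d \<and> d \<le> f then \<psi> * \<phi> else 0)"

definition interval_category :: "nat \<Rightarrow> (interval, bit) cat" where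
  "interval_category n =
    \<lparr>Ob = {(a, b). 1 \<le> a \<and> a \<le> b \<and> b \<le> int n},
     Hom = interval_Hom,
     Ident = (\<lambda>x. 1),
     Comp = interval_Comp\<rparr>"

text \<open>
  The members of a multiset \<open>M\<close> are enumerated by the pairs \<open>(x, k)\<close> with \<open>k < count M x\<close>, so that
  \<open>M\<close> is the multiset of the \<open>fst i\<close> for \<open>i \<in> members M\<close>.  A morphism \<open>M \<rightarrow> N\<close> is a matrix
  indexed by \<open>members M\<close> (sources) and \<open>members N\<close> (targets), extended by \<open>0\<close>.
\<close>

definition members :: "'a multiset \<Rightarrow> ('a \<times> nat) set" where
  "members M = (SIGMA x:set_mset M. {..<count M x})"

type_synonym interval_matrix = "interval \<times> nat \<Rightarrow> interval \<times> nat \<Rightarrow> bit"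

definition multiset_Hom :: "interval multiset \<Rightarrow> interval multiset \<Rightarrow> interval_matrix set" where
  "multiset_Hom M N =
    {\<phi>. \<forall>i j. if i \<in> members M \<and> j \<in> members N
               then \<phi> i j \<in> interval_Hom (fst i) (fst j) else \<phi> i j = 0}"

definition multiset_Ident :: "interval multiset \<Rightarrow> interval_matrix" where
  "multiset_Ident M = (\<lambda>i j. if i = j \<and> i \<in> members M then 1 else 0)"

definition multiset_Comp ::
    "interval multiset \<Rightarrow> interval multiset \<Rightarrow> interval multiset \<Rightarrow>
     interval_matrix \<Rightarrow> interval_matrix \<Rightarrow> interval_matrix" where
  "multiset_Comp M N P \<psi> \<phi> =
    (\<lambda>i k. \<Sum>j \<in> members N. interval_Comp (fst i) (fst j) (fst k) (\<psi> j k) (\<phi> i j))"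

definition multiset_category :: "nat \<Rightarrow> (interval multiset, interval_matrix) cat" where
  "multiset_category n =
    \<lparr>Ob = {M. set_mset M \<subseteq> Ob (interval_category n)},
     Hom = multiset_Hom,
     Ident = multiset_Ident,
     Comp = multiset_Comp\<rparr>"

definition matrix_scale :: "bit \<Rightarrow> interval_matrix \<Rightarrow> interval_matrix" where
  "matrix_scale c \<phi> = (\<lambda>i j. c * \<phi> i j)"

text \<open>The morphism \<open>\<phi> : x \<rightarrow> y\<close> of intervals as a matrix with one entry \<open>{#x#} \<rightarrow> {#y#}\<close>.\<close>

definition singleton_matrix :: "interval \<Rightarrow> interval \<Rightarrow> bit \<Rightarrow> interval_matrix" where
  "singleton_matrix x y \<phi> = (\<lambda>i j. if i = (x, 0) \<and> j = (y, 0) then \<phi> else 0)"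

end

theory Submission
  imports Defs
begin

text \<open>
  The category of multisets of intervals is the category of representations of a linearly
  oriented quiver with \<open>n\<close> vertices in disguise: the interval $[a,b]$ is the representation that is
  one-dimensional at the vertices $a,\dots,b$.  The proof does not pass to representations.  The
  elements of degree \<open>t\<close> of a multiset \<open>M\<close> are instead taken to be the morphisms $[1,t] \to M$, since
  $[1,t] \to [a,b]$ is non-zero exactly if $a \le t \le b$, and diagrams are chased with these
  elements.

  The only cokernel computed by hand is the one of a non-zero morphism \<open>s\<close> from $[t,t]$ to a
  multiset \<open>N\<close>.  Its non-zero entries end in intervals of the form $[t,d]$, and these are linearly
  ordered by inclusion.  If $[t,d]$ is the smallest one that occurs, then the other entries factor
  through the inclusion $[t,t] \to [t,d]$, so that after a change of basis of \<open>N\<close> the morphism \<open>s\<close> is this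
  inclusion, and the cokernel is obtained by replacing $[t,d]$ with $[t+1,d]$
  (\<open>exact_cokernel_of_summand\<close>, \<open>exact_cokernel_socle\<close>).  It is also exact on elements.

  If a morphism \<open>f : M \<rightarrow> N\<close> is non-zero, then an element of least degree among those that \<open>f\<close> does not
  kill has an image that comes from a morphism $[t,t] \to N$.  Dividing \<open>N\<close> by it makes \<open>N\<close> smaller
  without changing the cokernel of \<open>f\<close>, so induction provides every morphism with a cokernel that is
  exact on elements (\<open>exact_cokernel_exists\<close>).  Exactness implies that a monomorphism is the kernel of
  its cokernel (\<open>monic_is_kernel\<close>): lifting a morphism $[a,b] \to N$ amounts to lifting an element of
  degree \<open>b\<close> that dies in degree \<open>a - 1\<close>.  Kernels, and epimorphisms as cokernels, follow from the
  duality that reflects intervals and transposes matrices.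

  For the length, let \<open>element_count M\<close> be the product over \<open>t\<close> of the numbers of elements of degree \<open>t\<close>.
  It is multiplicative along a monomorphism and its cokernel, and it is 2 on simple objects
  because each of these is isomorphic to some $[t,t]$.  Hence it is $2^k$ for an object with a
  composition series of length \<open>k\<close>, while it is $2^{b-a+1}$ for the interval $[a,b]$.
\<close>

text \<open>
  Matrix entries are indexed by pairs \<open>i\<close>, whose interval is \<open>fst i\<close>; quantifiers over such indices
  are kept whole, so that facts about \<open>i\<close> and \<open>fst i\<close> still match.
\<close>

declare split_paired_All [simp del] split_paired_Ex [simp del]

section \<open>Preadditive categories\<close>

lemma (in category) monicD:
  assumes "is_monic C x y f" "w \<in> Ob C" "g \<in> Hom C w x" "h \<in> Hom C w x"
    and "Comp C w x y f g = Comp C w x y f h"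
  shows "g = h"
  using assms by (simp add: is_monic_def)

lemma (in category) epicD:
  assumes "is_epic C x y f" "z \<in> Ob C" "g \<in> Hom C y z" "h \<in> Hom C y z"
    and "Comp C x y z g f = Comp C x y z h f"
  shows "g = h"
  using assms by (simp add: is_epic_def)

text \<open>
  A name for the body of the existential statement in \<open>is_direct_sum\<close>, so that the four structure
  morphisms of a decomposition can be passed between lemmas.
\<close>

definition biproduct ::
    "('o, 'm::ab_group_add) cat \<Rightarrow> 'o \<Rightarrow> 'o \<Rightarrow> 'o \<Rightarrow> 'm \<Rightarrow> 'm \<Rightarrow> 'm \<Rightarrow> 'm \<Rightarrow> bool" where
  "biproduct C x y S i1 i2 p1 p2 \<longleftrightarrow> x \<in> Ob C \<and> y \<in> Ob C \<and> S \<in> Ob C \<and>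
    i1 \<in> Hom C x S \<and> i2 \<in> Hom C y S \<and> p1 \<in> Hom C S x \<and> p2 \<in> Hom C S y \<and>
    Comp C x S x p1 i1 = Ident C x \<and> Comp C y S y p2 i2 = Ident C y \<and>
    Comp C y S x p1 i2 = 0 \<and> Comp C x S y p2 i1 = 0 \<and>
    Comp C S x S i1 p1 + Comp C S y S i2 p2 = Ident C S"

lemma biproductD:
  assumes "biproduct C x y S i1 i2 p1 p2"
  shows "x \<in> Ob C" "y \<in> Ob C" "S \<in> Ob C"
    "i1 \<in> Hom C x S" "i2 \<in> Hom C y S" "p1 \<in> Hom C S x" "p2 \<in> Hom C S y"
    "Comp C x S x p1 i1 = Ident C x" "Comp C y S y p2 i2 = Ident C y"
    "Comp C y S x p1 i2 = 0" "Comp C x S y p2 i1 = 0"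
    "Comp C S x S i1 p1 + Comp C S y S i2 p2 = Ident C S"
  using assms by (simp_all add: biproduct_def)

lemma is_direct_sum_iff: "is_direct_sum C x y S \<longleftrightarrow> (\<exists>i1 i2 p1 p2. biproduct C x y S i1 i2 p1 p2)"
  unfolding is_direct_sum_def biproduct_def by blast

text \<open>
  A cokernel that can be computed on elements, where an element of \<open>y\<close> is a morphism from one of the
  test objects in \<open>G\<close>: the elements that \<open>q\<close> kills come from \<open>x\<close>, and every element of \<open>Q\<close> lifts to \<open>y\<close>.
  The first property is what makes monomorphisms kernels and the second is what makes numbers of
  elements multiplicative; both survive the construction of a cokernel in steps.
\<close>

definition exact_cokernel ::
    "('o, 'm::ab_group_add) cat \<Rightarrow> 'o set \<Rightarrow> 'o \<Rightarrow> 'o \<Rightarrow> 'm \<Rightarrow> 'o \<Rightarrow> 'm \<Rightarrow> bool" where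
  "exact_cokernel C G x y f Q q \<longleftrightarrow> is_cokernel C x y f Q q \<and>
    (\<forall>p\<in>G. \<forall>v\<in>Hom C p y. Comp C p y Q q v = 0 \<longrightarrow> (\<exists>u\<in>Hom C p x. Comp C p x y f u = v)) \<and>
    (\<forall>p\<in>G. \<forall>w\<in>Hom C p Q. \<exists>v\<in>Hom C p y. Comp C p y Q q v = w)"

lemma exact_cokernelD:
  assumes "exact_cokernel C G x y f Q q"
  shows "is_cokernel C x y f Q q" "Q \<in> Ob C" "q \<in> Hom C y Q" "Comp C x y Q q f = 0"
  using assms by (auto simp: exact_cokernel_def is_cokernel_def)

lemma exact_cokernel_exact:
  assumes "exact_cokernel C G x y f Q q" "p \<in> G" "v \<in> Hom C p y" "Comp C p y Q q v = 0"
  obtains u where "u \<in> Hom C p x" "Comp C p x y f u = v"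
  using assms unfolding exact_cokernel_def by blast

lemma exact_cokernel_surj:
  assumes "exact_cokernel C G x y f Q q" "p \<in> G" "w \<in> Hom C p Q"
  obtains v where "v \<in> Hom C p y" "Comp C p y Q q v = w"
  using assms unfolding exact_cokernel_def by blast

lemma is_cokernel_factor:
  assumes "is_cokernel C x y f Q q" "w \<in> Ob C" "g \<in> Hom C y w" "Comp C x y w g f = 0"
  obtains h where "h \<in> Hom C Q w" "Comp C y Q w h q = g"
  using assms unfolding is_cokernel_def by metis

context preadditive_category
begin

lemmas in_Hom [simp] = Ident_in_Hom Comp_in_Hom zero_in_Hom add_in_Hom uminus_in_Hom
lemmas Comp_Ident [simp] = Comp_Ident_right Comp_Ident_left

lemma diff_in_Hom [simp]:
  "\<lbrakk>x \<in> Ob C; y \<in> Ob C; f \<in> Hom C x y; g \<in> Hom C x y\<rbrakk> \<Longrightarrow> f - g \<in> Hom C x y"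
  using add_in_Hom [of x y f "- g"] by simp

lemma Comp_zero_left [simp]:
  assumes "x \<in> Ob C" "y \<in> Ob C" "z \<in> Ob C" "f \<in> Hom C x y"
  shows "Comp C x y z 0 f = 0"
  using Comp_add_left [of x y z f 0 0] assms by simp

lemma Comp_zero_right [simp]:
  assumes "x \<in> Ob C" "y \<in> Ob C" "z \<in> Ob C" "g \<in> Hom C y z"
  shows "Comp C x y z g 0 = 0"
  using Comp_add_right [of x y z 0 0 g] assms by simp

lemma Comp_diff_left:
  assumes "x \<in> Ob C" "y \<in> Ob C" "z \<in> Ob C" "f \<in> Hom C x y" "g \<in> Hom C y z" "g' \<in> Hom C y z"
  shows "Comp C x y z (g - g') f = Comp C x y z g f - Comp C x y z g' f"
  using Comp_add_left [of x y z f "g - g'" g'] assms by simp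

lemma Comp_diff_right:
  assumes "x \<in> Ob C" "y \<in> Ob C" "z \<in> Ob C" "f \<in> Hom C x y" "f' \<in> Hom C x y" "g \<in> Hom C y z"
  shows "Comp C x y z g (f - f') = Comp C x y z g f - Comp C x y z g f'"
  using Comp_add_right [of x y z "f - f'" f' g] assms by simp

lemma Comp_uminus_left:
  assumes "x \<in> Ob C" "y \<in> Ob C" "z \<in> Ob C" "f \<in> Hom C x y" "g \<in> Hom C y z"
  shows "Comp C x y z (- g) f = - Comp C x y z g f"
  using Comp_diff_left [of x y z f 0 g] assms by simp

lemma Comp_uminus_right:
  assumes "x \<in> Ob C" "y \<in> Ob C" "z \<in> Ob C" "f \<in> Hom C x y" "g \<in> Hom C y z"
  shows "Comp C x y z g (- f) = - Comp C x y z g f"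
  using Comp_diff_right [of x y z 0 f g] assms by simp

lemmas Comp_linear = Comp_add_left Comp_add_right Comp_diff_left Comp_diff_right
  Comp_uminus_left Comp_uminus_right

lemma is_monicI:
  assumes "x \<in> Ob C" "y \<in> Ob C" "f \<in> Hom C x y"
    and "\<And>w g. \<lbrakk>w \<in> Ob C; g \<in> Hom C w x; Comp C w x y f g = 0\<rbrakk> \<Longrightarrow> g = 0"
  shows "is_monic C x y f"
  unfolding is_monic_def
proof (intro conjI ballI impI)
  fix w g h assume "w \<in> Ob C" "g \<in> Hom C w x" "h \<in> Hom C w x"
    "Comp C w x y f g = Comp C w x y f h"
  then show "g = h"
    using assms(4)[of w "g - h"] assms(1-3) by (simp add: Comp_diff_right)
qed (use assms in simp)

lemma is_epicI:
  assumes "x \<in> Ob C" "y \<in> Ob C" "f \<in> Hom C x y"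
    and "\<And>z g. \<lbrakk>z \<in> Ob C; g \<in> Hom C y z; Comp C x y z g f = 0\<rbrakk> \<Longrightarrow> g = 0"
  shows "is_epic C x y f"
  unfolding is_epic_def
proof (intro conjI ballI impI)
  fix z g h assume "z \<in> Ob C" "g \<in> Hom C y z" "h \<in> Hom C y z"
    "Comp C x y z g f = Comp C x y z h f"
  then show "g = h"
    using assms(4)[of z "g - h"] assms(1-3) by (simp add: Comp_diff_left)
qed (use assms in simp)

lemma monic_zeroD:
  assumes "is_monic C x y f" "x \<in> Ob C" "y \<in> Ob C" "w \<in> Ob C" "g \<in> Hom C w x" "Comp C w x y f g = 0"
  shows "g = 0"
  using monicD [OF assms(1,4,5), of 0] assms by (simp add: is_monic_def)

lemma epic_zeroD:
  assumes "is_epic C x y f" "x \<in> Ob C" "y \<in> Ob C" "z \<in> Ob C" "g \<in> Hom C y z" "Comp C x y z g f = 0"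
  shows "g = 0"
  using epicD [OF assms(1,4,5), of 0] assms by (simp add: is_epic_def)

lemma epic_Comp:
  assumes f: "is_epic C x y f" and g: "is_epic C y z g" and ob: "x \<in> Ob C" "y \<in> Ob C" "z \<in> Ob C"
  shows "is_epic C x z (Comp C x y z g f)"
proof (rule is_epicI)
  have fg: "f \<in> Hom C x y" "g \<in> Hom C y z" using f g by (auto simp: is_epic_def)
  then show "Comp C x y z g f \<in> Hom C x z" using ob by simp
  fix w h assume w: "w \<in> Ob C" "h \<in> Hom C z w" "Comp C x z w h (Comp C x y z g f) = 0"
  then have "Comp C y z w h g = 0"
    using epic_zeroD [OF f, of w "Comp C y z w h g"] fg ob by (simp add: Comp_assoc)
  then show "h = 0" using epic_zeroD [OF g] w ob by simp
qed (use ob in auto)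

lemma is_cokernelI:
  assumes "x \<in> Ob C" "y \<in> Ob C" "Q \<in> Ob C" "is_epic C y Q q" "Comp C x y Q q f = 0"
    and "\<And>w g. \<lbrakk>w \<in> Ob C; g \<in> Hom C y w; Comp C x y w g f = 0\<rbrakk>
          \<Longrightarrow> \<exists>h\<in>Hom C Q w. Comp C y Q w h q = g"
  shows "is_cokernel C x y f Q q"
  unfolding is_cokernel_def
proof (intro conjI ballI impI)
  fix w g assume w: "w \<in> Ob C" and "g \<in> Hom C y w" "Comp C x y w g f = 0"
  with assms(6) obtain h where h: "h \<in> Hom C Q w \<and> Comp C y Q w h q = g" by blast
  moreover have "h' = h" if "h' \<in> Hom C Q w \<and> Comp C y Q w h' q = g" for h'
    using that h w epicD [OF assms(4), of w h' h] by simp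
  ultimately show "\<exists>!h. h \<in> Hom C Q w \<and> Comp C y Q w h q = g" by (rule ex1I)
qed (use assms in \<open>auto simp: is_epic_def\<close>)

lemma is_kernelI:
  assumes "K \<in> Ob C" "x \<in> Ob C" "is_monic C K x k" "Comp C K x y f k = 0"
    and "\<And>w g. \<lbrakk>w \<in> Ob C; g \<in> Hom C w x; Comp C w x y f g = 0\<rbrakk>
          \<Longrightarrow> \<exists>h\<in>Hom C w K. Comp C w K x k h = g"
  shows "is_kernel C x y f K k"
  unfolding is_kernel_def
proof (intro conjI ballI impI)
  fix w g assume w: "w \<in> Ob C" and "g \<in> Hom C w x" "Comp C w x y f g = 0"
  with assms(5) obtain h where h: "h \<in> Hom C w K \<and> Comp C w K x k h = g" by blast
  moreover have "h' = h" if "h' \<in> Hom C w K \<and> Comp C w K x k h' = g" for h'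
    using that h w monicD [OF assms(3), of w h' h] by simp
  ultimately show "\<exists>!h. h \<in> Hom C w K \<and> Comp C w K x k h = g" by (rule ex1I)
qed (use assms in \<open>auto simp: is_monic_def\<close>)

lemma cokernel_epic:
  assumes coker: "is_cokernel C x y f Q q" and ob: "x \<in> Ob C" "y \<in> Ob C" and f: "f \<in> Hom C x y"
  shows "is_epic C y Q q"
  unfolding is_epic_def
proof (intro conjI ballI impI)
  show q: "q \<in> Hom C y Q" using coker by (simp add: is_cokernel_def)
  fix w g h assume w: "w \<in> Ob C" "g \<in> Hom C Q w" "h \<in> Hom C Q w"
    and eq: "Comp C y Q w g q = Comp C y Q w h q"
  have Q: "Q \<in> Ob C" and "Comp C x y Q q f = 0"
    using coker by (auto simp: is_cokernel_def)
  then have "Comp C x y w (Comp C y Q w h q) f = 0"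
    using w ob f q by (simp add: Comp_assoc)
  then have "\<exists>!k. k \<in> Hom C Q w \<and> Comp C y Q w k q = Comp C y Q w h q"
    using coker w ob Q q by (simp add: is_cokernel_def)
  with w eq show "g = h" by blast
qed

lemma zero_object_iff: "zero_object C z \<longleftrightarrow> z \<in> Ob C \<and> Ident C z = 0"
proof
  assume "zero_object C z"
  then show "z \<in> Ob C \<and> Ident C z = 0"
    unfolding zero_object_def using Ident_in_Hom zero_in_Hom by metis
next
  assume z: "z \<in> Ob C \<and> Ident C z = 0"
  have "f = 0" if "x \<in> Ob C" "f \<in> Hom C x z" for x f
    using Comp_Ident_left [of x z f] that z by simp
  moreover have "f = 0" if "x \<in> Ob C" "f \<in> Hom C z x" for x f
    using Comp_Ident_right [of z x f] that z by simp
  ultimately show "zero_object C z"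
    unfolding zero_object_def using z zero_in_Hom by metis
qed

lemma biproduct_into:
  assumes b: "biproduct C x y S i1 i2 p1 p2" and w: "w \<in> Ob C" "g \<in> Hom C w S"
  shows "Comp C w x S i1 (Comp C w S x p1 g) + Comp C w y S i2 (Comp C w S y p2 g) = g"
proof -
  note bD = biproductD [OF b]
  have "Comp C w S S (Comp C S x S i1 p1 + Comp C S y S i2 p2) g = g"
    using bD(12) bD(3) w by simp
  then show ?thesis
    using bD(1-7) w by (simp add: Comp_add_left Comp_assoc)
qed

lemma biproduct_from:
  assumes b: "biproduct C x y S i1 i2 p1 p2" and w: "w \<in> Ob C" "g \<in> Hom C S w"
  shows "Comp C S x w (Comp C x S w g i1) p1 + Comp C S y w (Comp C y S w g i2) p2 = g"
proof -
  note bD = biproductD [OF b]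
  have "Comp C S S w g (Comp C S x S i1 p1 + Comp C S y S i2 p2) = g"
    using bD(12) bD(3) w by simp
  then show ?thesis
    using bD(1-7) w by (simp add: Comp_add_right Comp_assoc)
qed

lemma biproduct_p2_epic:
  assumes b: "biproduct C x y S i1 i2 p1 p2"
  shows "is_epic C S y p2"
proof -
  have b': "x \<in> Ob C" "y \<in> Ob C" "S \<in> Ob C" "i1 \<in> Hom C x S" "i2 \<in> Hom C y S" "p1 \<in> Hom C S x" "p2 \<in> Hom C S y"
    "Comp C y S y p2 i2 = Ident C y"
    using b by (auto simp: biproduct_def)
  show ?thesis
  proof (rule is_epicI)
    fix z g assume g: "z \<in> Ob C" "g \<in> Hom C y z" "Comp C S y z g p2 = 0"
    then have "Comp C y S z (Comp C S y z g p2) i2 = 0" using b' by simp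
    then show "g = 0" using g(1,2) b' by (simp add: Comp_assoc)
  qed (use b' in auto)
qed

lemma exact_cokernel_zero:
  assumes ob: "x \<in> Ob C" "y \<in> Ob C" and G: "G \<subseteq> Ob C"
  shows "exact_cokernel C G x y 0 y (Ident C y)"
  unfolding exact_cokernel_def
proof (intro conjI ballI impI)
  show "is_cokernel C x y 0 y (Ident C y)"
    by (rule is_cokernelI) (use ob in \<open>auto intro!: is_epicI\<close>)
next
  fix p v assume "p \<in> G" "v \<in> Hom C p y"
  with ob G have p: "p \<in> Ob C" "v \<in> Hom C p y" "Comp C p y y (Ident C y) v = v" by auto
  then show "\<exists>w\<in>Hom C p y. Comp C p y y (Ident C y) w = v" by blast
  assume "Comp C p y y (Ident C y) v = 0"
  with p ob show "\<exists>u\<in>Hom C p x. Comp C p x y 0 u = v" by (intro bexI [of _ 0]) auto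
qed

text \<open>
  The cokernel of \<open>s : S \<rightarrow> N\<close> for \<open>N = N0 \<oplus> y\<close>, when the component of \<open>s\<close> in \<open>N0\<close> factors as \<open>r\<close> after
  the component \<open>\<iota>\<close> in \<open>y\<close>.  The automorphism of \<open>N\<close> that subtracts \<open>r\<close> from the first component takes \<open>s\<close>
  to \<open>\<iota>\<close> followed by the inclusion of \<open>y\<close>, so that the cokernel is \<open>N0 \<oplus> y'\<close> with \<open>y'\<close> the cokernel of \<open>\<iota>\<close>.
  The formula for \<open>q\<close> combines this automorphism with the projection.
\<close>

lemma exact_cokernel_of_summand:
  assumes G: "G \<subseteq> Ob C"
    and b: "biproduct C N0 y N i1 i2 p1 p2" and b': "biproduct C N0 y' N' j1 j2 o1 o2"
    and S: "S \<in> Ob C" and s: "s \<in> Hom C S N" and r: "r \<in> Hom C y N0"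
    and p2s: "Comp C S N y p2 s = \<iota>" and p1s: "Comp C S N N0 p1 s = Comp C S y N0 r \<iota>"
    and coker: "exact_cokernel C G S y \<iota> y' \<rho>"
  defines "q \<equiv> Comp C N N0 N' j1 (p1 - Comp C N y N0 r p2) + Comp C N y' N' j2 (Comp C N y y' \<rho> p2)"
  shows "exact_cokernel C G S N s N' q"
proof -
  note [simp] = Comp_linear Comp_assoc
  have ob [simp]: "N0 \<in> Ob C" "y \<in> Ob C" "y' \<in> Ob C" "N \<in> Ob C" "N' \<in> Ob C" "S \<in> Ob C"
    and h [simp]: "i1 \<in> Hom C N0 N" "i2 \<in> Hom C y N" "p1 \<in> Hom C N N0" "p2 \<in> Hom C N y"
    "j1 \<in> Hom C N0 N'" "j2 \<in> Hom C y' N'" "o1 \<in> Hom C N' N0" "o2 \<in> Hom C N' y'"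
    and bs [simp]: "Comp C N0 N N0 p1 i1 = Ident C N0" "Comp C y N y p2 i2 = Ident C y"
      "Comp C y N N0 p1 i2 = 0" "Comp C N0 N y p2 i1 = 0"
      "Comp C N0 N' N0 o1 j1 = Ident C N0" "Comp C y' N' y' o2 j2 = Ident C y'"
      "Comp C y' N' N0 o1 j2 = 0" "Comp C N0 N' y' o2 j1 = 0"
    using b b' S by (auto simp: biproduct_def)
  note [simp] = r s
  have \<iota> [simp]: "\<iota> \<in> Hom C S y"
    using p2s by (metis Comp_in_Hom h(4) ob(2,4,6) s)
  have \<rho> [simp]: "\<rho> \<in> Hom C y y'" "Comp C S y y' \<rho> \<iota> = 0"
    using exact_cokernelD [OF coker] by auto
  have q [simp]: "q \<in> Hom C N N'" by (simp add: q_def)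
  have q_comp: "Comp C w N N' q v = Comp C w N0 N' j1 (Comp C w N N0 p1 v - Comp C w y N0 r (Comp C w N y p2 v))
      + Comp C w y' N' j2 (Comp C w y y' \<rho> (Comp C w N y p2 v))"
    if "w \<in> Ob C" "v \<in> Hom C w N" for w v
    using that by (simp add: q_def)
  have o_q: "Comp C w N' N0 o1 (Comp C w N N' q v) = Comp C w N N0 p1 v - Comp C w y N0 r (Comp C w N y p2 v)"
    "Comp C w N' y' o2 (Comp C w N N' q v) = Comp C w y y' \<rho> (Comp C w N y p2 v)"
    if "w \<in> Ob C" "v \<in> Hom C w N" for w v
  proof -
    \<comment> \<open>Associativity from right to left, to bring the structure morphisms of \<open>N'\<close> together.\<close>
    have *: "Comp C w N0 N0 (Comp C N0 N' N0 o1 j1) u = Comp C w N' N0 o1 (Comp C w N0 N' j1 u)"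
      "Comp C w N0 y' (Comp C N0 N' y' o2 j1) u = Comp C w N' y' o2 (Comp C w N0 N' j1 u)"
      if "u \<in> Hom C w N0" for u
      by (rule Comp_assoc; use that \<open>w \<in> Ob C\<close> in simp)+
    have **: "Comp C w y' N0 (Comp C y' N' N0 o1 j2) u = Comp C w N' N0 o1 (Comp C w y' N' j2 u)"
      "Comp C w y' y' (Comp C y' N' y' o2 j2) u = Comp C w N' y' o2 (Comp C w y' N' j2 u)"
      if "u \<in> Hom C w y'" for u
      by (rule Comp_assoc; use that \<open>w \<in> Ob C\<close> in simp)+
    show "Comp C w N' N0 o1 (Comp C w N N' q v) = Comp C w N N0 p1 v - Comp C w y N0 r (Comp C w N y p2 v)"
      "Comp C w N' y' o2 (Comp C w N N' q v) = Comp C w y y' \<rho> (Comp C w N y p2 v)"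
      unfolding q_comp [OF that] using that by (simp_all flip: * **)
  qed
  have qs: "Comp C S N N' q s = 0"
    by (simp add: q_comp p1s p2s)
  have q_i1: "Comp C N0 N N' q i1 = j1" and q_i2: "Comp C y N N' q i2 = Comp C y y' N' j2 \<rho> - Comp C y N0 N' j1 r"
    by (simp_all add: q_comp)
  have surj: "\<exists>v\<in>Hom C p N. Comp C p N N' q v = w" if p: "p \<in> G" and w: "w \<in> Hom C p N'" for p w
  proof -
    have [simp]: "p \<in> Ob C" using p G by auto
    note [simp] = w
    obtain v2 where v2 [simp]: "v2 \<in> Hom C p y" and v2': "Comp C p y y' \<rho> v2 = Comp C p N' y' o2 w"
      using exact_cokernel_surj [OF coker p, of "Comp C p N' y' o2 w"] by auto
    define v1 where "v1 = Comp C p N' N0 o1 w + Comp C p y N0 r v2"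
    have [simp]: "v1 \<in> Hom C p N0" by (simp add: v1_def)
    define v where "v = Comp C p N0 N i1 v1 + Comp C p y N i2 v2"
    have [simp]: "v \<in> Hom C p N" by (simp add: v_def)
    have "Comp C p N N' q v = Comp C p N0 N' j1 v1 + (Comp C p y' N' j2 (Comp C p y y' \<rho> v2) - Comp C p N0 N' j1 (Comp C p y N0 r v2))"
      using Comp_assoc [of p N0 N N' v1 i1 q] Comp_assoc [of p y N N' v2 i2 q]
      by (simp add: v_def q_i1 q_i2 del: Comp_assoc) (simp add: v_def q_i1 q_i2)
    also have "\<dots> = Comp C p N0 N' j1 (Comp C p N' N0 o1 w) + Comp C p y' N' j2 (Comp C p N' y' o2 w)"
      by (simp add: v2' v1_def)
    also have "\<dots> = w" by (rule biproduct_into [OF b']) auto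
    finally show ?thesis by (auto intro: bexI [of _ v])
  qed
  have exact: "\<exists>u\<in>Hom C p S. Comp C p S N s u = v"
    if p: "p \<in> G" and v: "v \<in> Hom C p N" and qv: "Comp C p N N' q v = 0" for p v
  proof -
    have [simp]: "p \<in> Ob C" using p G by auto
    note [simp] = v
    have 1: "Comp C p N N0 p1 v = Comp C p y N0 r (Comp C p N y p2 v)"
      and 2: "Comp C p y y' \<rho> (Comp C p N y p2 v) = 0"
      using o_q [of p v] qv by simp_all
    obtain u where u [simp]: "u \<in> Hom C p S" and u': "Comp C p S y \<iota> u = Comp C p N y p2 v"
      using exact_cokernel_exact [OF coker p, of "Comp C p N y p2 v"] 2 by auto
    have "Comp C p S N s u = v"
    proof -
      have a: "Comp C p N y p2 (Comp C p S N s u) = Comp C p N y p2 v"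
        using Comp_assoc [of p S N y u s p2] by (simp add: p2s u' del: Comp_assoc)
      have b1: "Comp C p N N0 p1 (Comp C p S N s u) = Comp C p N N0 p1 v"
        using Comp_assoc [of p S N N0 u s p1] Comp_assoc [of p S y N0 u \<iota> r] by (simp add: p1s u' 1 del: Comp_assoc)
      show ?thesis
        using biproduct_into [OF b, of p v] biproduct_into [OF b, of p "Comp C p S N s u"] a b1 by simp
    qed
    with u show ?thesis by blast
  qed
  have epi: "is_epic C N N' q"
  proof (rule is_epicI)
    fix z g assume z [simp]: "z \<in> Ob C" and g [simp]: "g \<in> Hom C N' z" and "Comp C N N' z g q = 0"
    then have gq: "Comp C w N' z g (Comp C w N N' q i) = 0" if "w \<in> Ob C" "i \<in> Hom C w N" for w i
      using that by (simp flip: Comp_assoc)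
    have g1: "Comp C N0 N' z g j1 = 0" using gq [of N0 i1] by (simp add: q_i1)
    have "Comp C y y' z (Comp C y' N' z g j2) \<rho> = Comp C y N' z g (Comp C y N N' q i2)
        + Comp C y N0 z (Comp C N0 N' z g j1) r"
      by (simp add: q_i2)
    then have "Comp C y y' z (Comp C y' N' z g j2) \<rho> = 0"
      using gq [of y i2] g1 by (simp del: Comp_assoc)
    then have g2: "Comp C y' N' z g j2 = 0"
      using epic_zeroD [OF cokernel_epic [OF exact_cokernelD(1) [OF coker]], of z "Comp C y' N' z g j2"] by simp
    show "g = 0" using biproduct_from [OF b', of z g] g1 g2 by (simp del: Comp_assoc)
  qed auto
  have "is_cokernel C S N s N' q"
  proof (rule is_cokernelI)
    fix z g assume z [simp]: "z \<in> Ob C" and g [simp]: "g \<in> Hom C N z" and gs: "Comp C S N z g s = 0"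
    \<comment> \<open>\<open>g s = 0\<close> says that \<open>g1 r + g2\<close> kills \<open>\<iota>\<close>; the resulting factor \<open>h\<close> is the component of the
      factorization of \<open>g\<close> on \<open>y'\<close>, and \<open>g1\<close> is the one on \<open>N0\<close>.\<close>
    define g1 g2 where "g1 = Comp C N0 N z g i1" and "g2 = Comp C y N z g i2"
    have [simp]: "g1 \<in> Hom C N0 z" "g2 \<in> Hom C y z" by (simp_all add: g1_def g2_def)
    have g': "g = Comp C N N0 z g1 p1 + Comp C N y z g2 p2"
      using biproduct_from [OF b, of z g] by (simp add: g1_def g2_def)
    have "Comp C S y z (Comp C y N0 z g1 r + g2) \<iota> = Comp C S N z g s"
      by (subst g') (simp add: p1s p2s)
    with gs obtain h where h [simp]: "h \<in> Hom C y' z" and h': "Comp C y y' z h \<rho> = Comp C y N0 z g1 r + g2"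
      using is_cokernel_factor [OF exact_cokernelD(1) [OF coker], of z "Comp C y N0 z g1 r + g2"] by auto
    define k where "k = Comp C N' N0 z g1 o1 + Comp C N' y' z h o2"
    have [simp]: "k \<in> Hom C N' z" by (simp add: k_def)
    have "Comp C N N' z k q = Comp C N N0 z g1 (Comp C N N' N0 o1 q) + Comp C N y' z h (Comp C N N' y' o2 q)"
      by (simp add: k_def)
    also have "Comp C N N' N0 o1 q = p1 - Comp C N y N0 r p2"
      using o_q(1) [of N "Ident C N"] by simp
    also have "Comp C N N' y' o2 q = Comp C N y y' \<rho> p2"
      using o_q(2) [of N "Ident C N"] by simp
    also have "Comp C N N0 z g1 (p1 - Comp C N y N0 r p2) + Comp C N y' z h (Comp C N y y' \<rho> p2)
      = Comp C N N0 z g1 (p1 - Comp C N y N0 r p2) + Comp C N y z (Comp C y y' z h \<rho>) p2"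
      by simp
    also have "\<dots> = g"
      unfolding h' by (subst g') simp
    finally show "\<exists>h\<in>Hom C N' z. Comp C N N' z h q = g" by (auto intro: bexI [of _ k])
  qed (use qs epi in auto)
  with exact surj show ?thesis unfolding exact_cokernel_def by blast
qed

text \<open>
  The induction step for cokernels: if \<open>f x\<close> is \<open>s\<close> after the epimorphism \<open>\<pi>\<close>, then a morphism that
  kills \<open>f\<close> also kills \<open>s\<close>, so it is enough to find the cokernel of \<open>f\<close> modulo \<open>s\<close>.
  That elements lift along \<open>\<pi>\<close> is what keeps the result exact: it shows that the elements coming from
  \<open>s\<close> come from \<open>f\<close>.
\<close>

lemma exact_cokernel_extend:
  assumes G: "G \<subseteq> Ob C" and ob: "M \<in> Ob C" "N \<in> Ob C" "S \<in> Ob C" "P \<in> Ob C"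
    and f: "f \<in> Hom C M N" and s: "s \<in> Hom C S N"
    and q: "exact_cokernel C G S N s N' q"
    and q': "exact_cokernel C G M N' (Comp C M N N' q f) Q q'"
    and x: "x \<in> Hom C P M" and \<pi>: "is_epic C P S \<pi>" and fx: "Comp C P M N f x = Comp C P S N s \<pi>"
    and lift: "\<And>p c. \<lbrakk>p \<in> G; c \<in> Hom C p S\<rbrakk> \<Longrightarrow> \<exists>c'\<in>Hom C p P. Comp C p P S \<pi> c' = c"
  shows "exact_cokernel C G M N f Q (Comp C N N' Q q' q)"
proof -
  note [simp] = ob f s x Comp_assoc
  have [simp]: "N' \<in> Ob C" "Q \<in> Ob C" "q \<in> Hom C N N'" "q' \<in> Hom C N' Q" "\<pi> \<in> Hom C P S"
    using exact_cokernelD [OF q] exact_cokernelD [OF q'] \<pi> by (auto simp: is_epic_def)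
  have qs: "Comp C S N N' q s = 0" and q'q: "Comp C M N' Q q' (Comp C M N N' q f) = 0"
    using exact_cokernelD [OF q] exact_cokernelD [OF q'] by auto
  have epi: "is_epic C N N' q" "is_epic C N' Q q'"
    using exact_cokernelD [OF q] exact_cokernelD [OF q'] by (auto intro: cokernel_epic)
  have "is_cokernel C M N f Q (Comp C N N' Q q' q)"
  proof (rule is_cokernelI)
    show "is_epic C N Q (Comp C N N' Q q' q)"
      using epi by (auto intro: epic_Comp)
    show "Comp C M N Q (Comp C N N' Q q' q) f = 0"
      using q'q by simp
    fix w g assume [simp]: "w \<in> Ob C" "g \<in> Hom C N w" and gf: "Comp C M N w g f = 0"
    have "Comp C P S w (Comp C S N w g s) \<pi> = Comp C P M w (Comp C M N w g f) x"
      by (simp add: fx)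
    then have "Comp C S N w g s = 0"
      using epic_zeroD [OF \<pi>, of w "Comp C S N w g s"] gf by (simp del: Comp_assoc)
    then obtain h where h: "h \<in> Hom C N' w" "Comp C N N' w h q = g"
      using is_cokernel_factor [OF exact_cokernelD(1) [OF q], of w g] by auto
    then have "Comp C M N' w h (Comp C M N N' q f) = 0"
      using gf Comp_assoc [of M N N' w f q h] by simp
    then obtain k where k: "k \<in> Hom C Q w" "Comp C N' Q w k q' = h"
      using is_cokernel_factor [OF exact_cokernelD(1) [OF q'], of w h] h by auto
    then have "Comp C N Q w k (Comp C N N' Q q' q) = g"
      using h Comp_assoc [of N N' Q w q q' k] by simp
    with k show "\<exists>h\<in>Hom C Q w. Comp C N Q w h (Comp C N N' Q q' q) = g" by blast
  qed auto
  moreover have "\<exists>u\<in>Hom C p M. Comp C p M N f u = v"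
    if p: "p \<in> G" and v: "v \<in> Hom C p N" and qv: "Comp C p N Q (Comp C N N' Q q' q) v = 0" for p v
  proof -
    have [simp]: "p \<in> Ob C" using p G by auto
    note [simp] = v
    have "Comp C p N' Q q' (Comp C p N N' q v) = 0" using qv by simp
    then obtain u where u [simp]: "u \<in> Hom C p M" and "Comp C p M N' (Comp C M N N' q f) u = Comp C p N N' q v"
      using exact_cokernel_exact [OF q' p, of "Comp C p N N' q v"] by auto
    then have "Comp C p N N' q (v - Comp C p M N f u) = 0" by (simp add: Comp_linear)
    then obtain c where c [simp]: "c \<in> Hom C p S" and c': "Comp C p S N s c = v - Comp C p M N f u"
      using exact_cokernel_exact [OF q p, of "v - Comp C p M N f u"] by auto
    \<comment> \<open>Modulo \<open>s\<close>, the element \<open>v\<close> is the image of \<open>u\<close>; the error \<open>s c\<close> is corrected by \<open>x d\<close>.\<close>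
    obtain d where d [simp]: "d \<in> Hom C p P" and d': "Comp C p P S \<pi> d = c"
      using lift p c by blast
    have "Comp C p M N f (Comp C p P M x d) = Comp C p P N (Comp C P M N f x) d" by simp
    also have "\<dots> = v - Comp C p M N f u" unfolding fx by (simp add: d' c')
    finally have "Comp C p M N f (Comp C p P M x d + u) = v" by (simp add: Comp_linear)
    then show ?thesis by (intro bexI [of _ "Comp C p P M x d + u"]) auto
  qed
  moreover have "\<exists>v\<in>Hom C p N. Comp C p N Q (Comp C N N' Q q' q) v = w"
    if p: "p \<in> G" and w: "w \<in> Hom C p Q" for p w
  proof -
    have [simp]: "p \<in> Ob C" using p G by auto
    obtain w' where w': "w' \<in> Hom C p N'" "Comp C p N' Q q' w' = w"
      using exact_cokernel_surj [OF q' p w] by auto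
    obtain v where v: "v \<in> Hom C p N" "Comp C p N N' q v = w'"
      using exact_cokernel_surj [OF q p w'(1)] by auto
    with w' have "Comp C p N Q (Comp C N N' Q q' q) v = w" by simp
    with v show ?thesis by blast
  qed
  ultimately show ?thesis unfolding exact_cokernel_def by blast
qed

lemma cokernel_unique:
  assumes q: "is_cokernel C x y f Q q" and q': "is_cokernel C x y f Q' q'"
    and ob: "x \<in> Ob C" "y \<in> Ob C" and f: "f \<in> Hom C x y"
  shows "\<exists>h. is_iso C Q Q' h"
proof -
  have D: "Q \<in> Ob C" "q \<in> Hom C y Q" "Comp C x y Q q f = 0"
    "Q' \<in> Ob C" "q' \<in> Hom C y Q'" "Comp C x y Q' q' f = 0"
    using q q' by (auto simp: is_cokernel_def)
  obtain h where h: "h \<in> Hom C Q Q'" "Comp C y Q Q' h q = q'"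
    using is_cokernel_factor [OF q D(4-6)] .
  obtain k where k: "k \<in> Hom C Q' Q" "Comp C y Q' Q k q' = q"
    using is_cokernel_factor [OF q' D(1-3)] .
  have "Comp C Q Q' Q k h = Ident C Q"
    using epicD [OF cokernel_epic [OF q ob f], of Q "Comp C Q Q' Q k h" "Ident C Q"] D h k ob
    by (simp add: Comp_assoc)
  moreover have "Comp C Q' Q Q' h k = Ident C Q'"
    using epicD [OF cokernel_epic [OF q' ob f], of Q' "Comp C Q' Q Q' h k" "Ident C Q'"] D h k ob
    by (simp add: Comp_assoc)
  ultimately show ?thesis using h k unfolding is_iso_def by blast
qed

lemma iso_card_Hom:
  assumes h: "is_iso C x y h" and ob: "x \<in> Ob C" "y \<in> Ob C" "p \<in> Ob C"
  shows "card (Hom C p x) = card (Hom C p y)"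
proof -
  obtain k where hk: "h \<in> Hom C x y" "k \<in> Hom C y x"
    "Comp C x y x k h = Ident C x" "Comp C y x y h k = Ident C y"
    using h unfolding is_iso_def by blast
  have "bij_betw (Comp C p x y h) (Hom C p x) (Hom C p y)"
    by (rule bij_betw_byWitness [where f' = "Comp C p y x k"])
      (use hk ob in \<open>auto simp flip: Comp_assoc\<close>)
  then show ?thesis by (rule bij_betw_same_card)
qed

text \<open>
  The usual count for a short exact sequence: a section of the surjection on elements makes the
  elements of \<open>y\<close> the pairs of an element of \<open>x\<close> and an element of \<open>Q\<close>.
\<close>

lemma card_Hom_exact:
  assumes q: "exact_cokernel C G x y m Q q" and m: "is_monic C x y m"
    and ob: "x \<in> Ob C" "y \<in> Ob C" and p: "p \<in> G" "p \<in> Ob C"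
  shows "card (Hom C p y) = card (Hom C p x) * card (Hom C p Q)"
proof -
  have D [simp]: "Q \<in> Ob C" "q \<in> Hom C y Q" "Comp C x y Q q m = 0" "m \<in> Hom C x y"
    using exact_cokernelD [OF q] m by (auto simp: is_monic_def)
  note [simp] = ob p
  have "\<forall>w\<in>Hom C p Q. \<exists>v. v \<in> Hom C p y \<and> Comp C p y Q q v = w"
    using q p unfolding exact_cokernel_def by blast
  then obtain \<sigma> where \<sigma> [simp]: "\<And>w. w \<in> Hom C p Q \<Longrightarrow> \<sigma> w \<in> Hom C p y"
    "\<And>w. w \<in> Hom C p Q \<Longrightarrow> Comp C p y Q q (\<sigma> w) = w"
    by metis
  define \<Psi> where "\<Psi> = (\<lambda>(u, w). Comp C p x y m u + \<sigma> w)"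
  have q\<Psi>: "Comp C p y Q q (\<Psi> (u, w)) = w" if "u \<in> Hom C p x" "w \<in> Hom C p Q" for u w
    using that by (simp add: \<Psi>_def Comp_linear flip: Comp_assoc)
  have "inj_on \<Psi> (Hom C p x \<times> Hom C p Q)"
  proof (rule inj_onI)
    fix a b assume a: "a \<in> Hom C p x \<times> Hom C p Q" and b: "b \<in> Hom C p x \<times> Hom C p Q" and eq: "\<Psi> a = \<Psi> b"
    obtain u w u' w' where ab: "a = (u, w)" "b = (u', w')" by (cases a, cases b)
    have w: "w = w'" using q\<Psi> [of u w] q\<Psi> [of u' w'] a b eq ab by simp
    with eq have "Comp C p x y m u = Comp C p x y m u'" by (simp add: \<Psi>_def ab)
    then have "u = u'" using monicD [OF m, of p u u'] a b ab by simp
    with w ab show "a = b" by simp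
  qed
  moreover have "\<Psi> ` (Hom C p x \<times> Hom C p Q) = Hom C p y"
  proof (intro equalityI subsetI)
    fix v assume v: "v \<in> Hom C p y"
    define w where "w = Comp C p y Q q v"
    have w: "w \<in> Hom C p Q" using v by (simp add: w_def)
    have "Comp C p y Q q (v - \<sigma> w) = 0" using v w by (simp add: Comp_linear w_def)
    then obtain u where u: "u \<in> Hom C p x" "Comp C p x y m u = v - \<sigma> w"
      using exact_cokernel_exact [OF q p(1), of "v - \<sigma> w"] v w by auto
    then have "v = \<Psi> (u, w)" by (simp add: \<Psi>_def)
    with u w show "v \<in> \<Psi> ` (Hom C p x \<times> Hom C p Q)" by blast
  qed (auto simp: \<Psi>_def)
  ultimately have "card (Hom C p x \<times> Hom C p Q) = card (Hom C p y)"
    using card_image by fastforce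
  then show ?thesis by (simp add: card_cartesian_product)
qed

text \<open>
  A decomposition gives two idempotents with sum 1, and one of them is 0 if there are no other
  endomorphisms than 0 and 1.
\<close>

lemma indecomposable_if_local_End:
  assumes x: "x \<in> Ob C" "\<not> zero_object C x" and End: "Hom C x x \<subseteq> {0, Ident C x}"
  shows "indecomposable C x"
  unfolding indecomposable_def
proof (intro conjI allI impI x)
  fix y z assume "is_direct_sum C y z x"
  then obtain i1 i2 p1 p2 where b: "biproduct C y z x i1 i2 p1 p2"
    by (auto simp: is_direct_sum_iff)
  note [simp] = biproductD(1-11) [OF b]
  have "Comp C x y x i1 p1 \<in> {0, Ident C x}" using End by (rule subsetD) simp
  then consider "Comp C x y x i1 p1 = 0" | "Comp C x z x i2 p2 = 0"
    using biproductD(12) [OF b] by auto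
  then show "zero_object C y \<or> zero_object C z"
  proof cases
    case 1
    have "Comp C y x y p1 (Comp C y x x (Comp C x y x i1 p1) i1) = Ident C y"
      by (simp add: Comp_assoc)
    with 1 show ?thesis by (simp add: zero_object_iff)
  next
    case 2
    have "Comp C z x z p2 (Comp C z x x (Comp C x z x i2 p2) i2) = Ident C z"
      by (simp add: Comp_assoc)
    with 2 show ?thesis by (simp add: zero_object_iff)
  qed
qed

lemma composition_series_extend:
  assumes X: "composition_series C K k X m" and y: "y \<in> Ob C"
    and "is_monic C K y i" "is_cokernel C K y i Q q" "simple_object C Q"
  shows "composition_series C y (Suc k) (X(Suc k := y)) (m(k := i))"
  using assms unfolding composition_series_def by (auto simp: less_Suc_eq le_Suc_eq)

text \<open>
  In the definition of an abelian category an epimorphism is a cokernel of some morphism; that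
  morphism factors through the kernel, which may therefore take its place.
\<close>

lemma epic_is_cokernel_of_kernel:
  assumes p: "is_cokernel C w x g y p" and k: "is_kernel C x y p K k"
    and ob: "w \<in> Ob C" "x \<in> Ob C" "y \<in> Ob C" and g: "g \<in> Hom C w x"
  shows "is_cokernel C K x k y p"
proof (rule is_cokernelI)
  have k': "K \<in> Ob C" "k \<in> Hom C K x" "Comp C K x y p k = 0"
    using k by (auto simp: is_kernel_def)
  then show "K \<in> Ob C" "Comp C K x y p k = 0" by auto
  show "is_epic C x y p" using p ob(1,2) g by (rule cokernel_epic)
  obtain h where h: "h \<in> Hom C w K" "Comp C w K x k h = g"
    using k p g ob unfolding is_kernel_def is_cokernel_def by metis
  fix z f assume z: "z \<in> Ob C" "f \<in> Hom C x z" "Comp C K x z f k = 0"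
  have "Comp C w K z (Comp C K x z f k) h = Comp C w x z f g"
    using Comp_assoc [of w K x z h k f] z k' h ob by simp
  then have "Comp C w x z f g = 0" using z ob k' h by simp
  then show "\<exists>h\<in>Hom C y z. Comp C x y z h p = f"
    using is_cokernel_factor [OF p z(1,2)] by blast
qed (use ob in auto)

lemma kernel_monic:
  assumes k: "is_kernel C x y f K k" and ob: "x \<in> Ob C" "y \<in> Ob C" and f: "f \<in> Hom C x y"
  shows "is_monic C K x k"
  unfolding is_monic_def
proof (intro conjI ballI impI)
  show k': "k \<in> Hom C K x" using k by (simp add: is_kernel_def)
  fix w g h assume w: "w \<in> Ob C" "g \<in> Hom C w K" "h \<in> Hom C w K"
    and eq: "Comp C w K x k g = Comp C w K x k h"
  have K: "K \<in> Ob C" and "Comp C K x y f k = 0"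
    using k by (auto simp: is_kernel_def)
  then have "Comp C w x y f (Comp C w K x k h) = 0"
    using w ob f k' by (simp flip: Comp_assoc)
  then have "\<exists>!l. l \<in> Hom C w K \<and> Comp C w K x k l = Comp C w K x k h"
    using k w ob K k' by (simp add: is_kernel_def)
  with w eq show "g = h" by blast
qed

end

section \<open>Duality\<close>

text \<open>
  A contravariant involution that preserves zero morphisms.  It exchanges kernels with
  cokernels and monomorphisms with epimorphisms, so that only one half of the axioms of an abelian
  category has to be verified.  The action on morphisms is the same function for all pairs of
  objects, as for the transposition of matrices.
\<close>

locale duality = preadditive_category C
  for C :: "('o, 'm::ab_group_add) cat" +
  fixes D :: "'o \<Rightarrow> 'o" and T :: "'m \<Rightarrow> 'm"
  assumes D_Ob: "x \<in> Ob C \<Longrightarrow> D x \<in> Ob C"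
    and D_D: "D (D x) = x"
    and T_Hom: "f \<in> Hom C x y \<Longrightarrow> T f \<in> Hom C (D y) (D x)"
    and T_T: "T (T f) = f"
    and T_zero: "T 0 = 0"
    and T_Comp: "T (Comp C x y z g f) = Comp C (D z) (D y) (D x) (T f) (T g)"
begin

lemma Comp_T: "Comp C z y x (T f) (T g) = T (Comp C (D x) (D y) (D z) g f)"
  by (simp add: T_Comp D_D)

lemma T_eq_iff: "T f = g \<longleftrightarrow> f = T g"
  using T_T by metis

lemma T_in_Hom_iff: "T f \<in> Hom C x y \<longleftrightarrow> f \<in> Hom C (D y) (D x)"
  using T_Hom [of f "D y" "D x"] T_Hom [of "T f" x y] by (auto simp: D_D T_T)

lemma kernel_of_dual_cokernel:
  assumes q: "is_cokernel C (D y) (D x) (T f) Q q"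
  shows "is_kernel C x y f (D Q) (T q)"
proof -
  have D: "Q \<in> Ob C" "q \<in> Hom C (D x) Q" "Comp C (D y) (D x) Q q (T f) = 0"
    using q by (auto simp: is_cokernel_def)
  have "\<exists>!h. h \<in> Hom C w (D Q) \<and> Comp C w (D Q) x (T q) h = g"
    if w: "w \<in> Ob C" "g \<in> Hom C w x" "Comp C w x y f g = 0" for w g
  proof -
    have "Comp C (D y) (D x) (D w) (T g) (T f) = 0"
      using w(3) by (simp add: Comp_T D_D T_zero)
    then have ex1: "\<exists>!h. h \<in> Hom C Q (D w) \<and> Comp C (D x) Q (D w) h q = T g"
      using q w D_Ob T_Hom by (simp add: is_cokernel_def)
    have iff: "(T h \<in> Hom C w (D Q) \<and> Comp C w (D Q) x (T q) (T h) = g) \<longleftrightarrow>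
        (h \<in> Hom C Q (D w) \<and> Comp C (D x) Q (D w) h q = T g)" for h
      by (simp add: Comp_T D_D T_in_Hom_iff T_eq_iff)
    from ex1 iff show ?thesis by (metis T_T)
  qed
  moreover have "Comp C (D Q) x y f (T q) = 0"
    using D(3) Comp_T [of "D Q" x y "T f" q] by (simp add: T_T D_D T_zero)
  ultimately show ?thesis
    using D D_Ob unfolding is_kernel_def by (simp add: T_in_Hom_iff D_D)
qed

lemma cokernel_of_dual_kernel:
  assumes k: "is_kernel C (D y) (D x) (T f) K k"
  shows "is_cokernel C x y f (D K) (T k)"
proof -
  have D: "K \<in> Ob C" "k \<in> Hom C K (D y)" "Comp C K (D y) (D x) (T f) k = 0"
    using k by (auto simp: is_kernel_def)
  have "\<exists>!h. h \<in> Hom C (D K) w \<and> Comp C y (D K) w h (T k) = g"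
    if w: "w \<in> Ob C" "g \<in> Hom C y w" "Comp C x y w g f = 0" for w g
  proof -
    have "Comp C (D w) (D y) (D x) (T f) (T g) = 0"
      using w(3) by (simp add: Comp_T D_D T_zero)
    then have ex1: "\<exists>!h. h \<in> Hom C (D w) K \<and> Comp C (D w) K (D y) k h = T g"
      using k w D_Ob T_Hom by (simp add: is_kernel_def)
    have iff: "(T h \<in> Hom C (D K) w \<and> Comp C y (D K) w (T h) (T k) = g) \<longleftrightarrow>
        (h \<in> Hom C (D w) K \<and> Comp C (D w) K (D y) k h = T g)" for h
      by (simp add: Comp_T D_D T_in_Hom_iff T_eq_iff)
    from ex1 iff show ?thesis by (metis T_T)
  qed
  moreover have "Comp C x y (D K) (T k) f = 0"
    using D(3) Comp_T [of x y "D K" k "T f"] by (simp add: T_T D_D T_zero)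
  ultimately show ?thesis
    using D D_Ob unfolding is_cokernel_def by (simp add: T_in_Hom_iff D_D)
qed

lemma monic_dual_of_epic:
  assumes f: "is_epic C x y f"
  shows "is_monic C (D y) (D x) (T f)"
  unfolding is_monic_def
proof (intro conjI ballI impI)
  show "T f \<in> Hom C (D y) (D x)" using f by (auto simp: is_epic_def T_Hom)
  fix w g h assume w: "w \<in> Ob C" "g \<in> Hom C w (D y)" "h \<in> Hom C w (D y)"
    and eq: "Comp C w (D y) (D x) (T f) g = Comp C w (D y) (D x) (T f) h"
  have "T (Comp C w (D y) (D x) (T f) g) = Comp C x y (D w) (T g) f" for g
    by (simp add: T_Comp D_D T_T)
  then have "Comp C x y (D w) (T g) f = Comp C x y (D w) (T h) f" using eq by metis
  then have "T g = T h"
    by (rule epicD [OF f, rotated -1]) (use w D_Ob in \<open>simp_all add: T_in_Hom_iff D_D\<close>)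
  then show "g = h" by (metis T_T)
qed

end

section \<open>The linear categories of intervals and of multisets of intervals\<close>

definition nonzero_Hom :: "interval \<Rightarrow> interval \<Rightarrow> bool" where
  "nonzero_Hom x y \<longleftrightarrow> fst x \<le> fst y \<and> fst y \<le> snd x \<and> snd x \<le> snd y"

lemma interval_Hom_eq: "interval_Hom x y = (if nonzero_Hom x y then UNIV else {0})"
  by (cases x; cases y) (simp add: nonzero_Hom_def)

lemma interval_Comp_eq:
  "interval_Comp x y z \<psi> \<phi> =
    (if fst x \<le> fst y \<and> fst y \<le> fst z \<and> fst z \<le> snd x \<and> snd x \<le> snd y \<and> snd y \<le> snd z
     then \<psi> * \<phi> else 0)"
  by (cases x; cases y; cases z) simp

text \<open>
  Four of the five inequalities in the composition rule hold as soon as both factors can be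
  non-zero; the remaining one, $e \le b$, says that the composite can be non-zero.
  Composition of morphisms is thus a product truncated to the admissible entries.
\<close>

lemma interval_Comp_of_nonzero_Hom:
  assumes "nonzero_Hom x y" "nonzero_Hom y z"
  shows "interval_Comp x y z \<psi> \<phi> = (if nonzero_Hom x z then \<psi> * \<phi> else 0)"
  using assms by (auto simp: interval_Comp_eq nonzero_Hom_def)

lemma interval_Comp_0 [simp]:
  "interval_Comp x y z 0 \<phi> = 0" "interval_Comp x y z \<psi> 0 = 0"
  by (simp_all add: interval_Comp_eq)

lemma interval_Comp_add:
  "interval_Comp x y z (\<psi> + \<psi>') \<phi> = interval_Comp x y z \<psi> \<phi> + interval_Comp x y z \<psi>' \<phi>"
  "interval_Comp x y z \<psi> (\<phi> + \<phi>') = interval_Comp x y z \<psi> \<phi> + interval_Comp x y z \<psi> \<phi>'"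
  by (simp_all only: interval_Comp_eq distrib_left distrib_right split: if_splits) auto

lemma interval_Comp_scale:
  "interval_Comp x y z (c * \<psi>) \<phi> = c * interval_Comp x y z \<psi> \<phi>"
  "interval_Comp x y z \<psi> (c * \<phi>) = c * interval_Comp x y z \<psi> \<phi>"
  by (simp_all add: interval_Comp_eq mult.left_commute)

lemma interval_Comp_assoc:
  "interval_Comp w x z (interval_Comp x y z \<theta> \<psi>) \<phi> = interval_Comp w y z \<theta> (interval_Comp w x y \<psi> \<phi>)"
  unfolding interval_Comp_eq by (auto simp: mult.assoc)

lemma interval_Comp_sum:
  "interval_Comp x y z (sum f A) \<phi> = (\<Sum>a\<in>A. interval_Comp x y z (f a) \<phi>)"
  "interval_Comp x y z \<psi> (sum f A) = (\<Sum>a\<in>A. interval_Comp x y z \<psi> (f a))"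
proof -
  show "interval_Comp x y z (sum f A) \<phi> = (\<Sum>a\<in>A. interval_Comp x y z (f a) \<phi>)"
    by (induction A rule: infinite_finite_induct) (auto simp: interval_Comp_add)
  show "interval_Comp x y z \<psi> (sum f A) = (\<Sum>a\<in>A. interval_Comp x y z \<psi> (f a))"
    by (induction A rule: infinite_finite_induct) (auto simp: interval_Comp_add)
qed

lemma interval_category_simps [simp]:
  "(a, b) \<in> Ob (interval_category n) \<longleftrightarrow> 1 \<le> a \<and> a \<le> b \<and> b \<le> int n"
  "Hom (interval_category n) = interval_Hom"
  "Ident (interval_category n) x = 1"
  "Comp (interval_category n) = interval_Comp"
  by (simp_all add: interval_category_def)

lemma Ob_interval_category:
  "x \<in> Ob (interval_category n) \<longleftrightarrow> 1 \<le> fst x \<and> fst x \<le> snd x \<and> snd x \<le> int n"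
  by (cases x) simp

lemma multiset_category_simps:
  "M \<in> Ob (multiset_category n) \<longleftrightarrow> set_mset M \<subseteq> Ob (interval_category n)"
  "Hom (multiset_category n) = multiset_Hom"
  "Ident (multiset_category n) = multiset_Ident"
  "Comp (multiset_category n) = multiset_Comp"
  by (simp_all add: multiset_category_def)

lemmas multiset_category_unfold = multiset_category_simps(2-4)

lemma linear_interval_category: "linear_category (interval_category n) (*)"
proof unfold_locales
  fix x y z f g assume "x \<in> Ob (interval_category n)" "y \<in> Ob (interval_category n)"
    "z \<in> Ob (interval_category n)" "f \<in> Hom (interval_category n) x y" "g \<in> Hom (interval_category n) y z"
  then show "Comp (interval_category n) x y z g f \<in> Hom (interval_category n) x z"
    by (auto simp: interval_Hom_eq interval_Comp_of_nonzero_Hom split: if_splits)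
qed (auto simp: interval_Hom_eq interval_Comp_eq nonzero_Hom_def Ob_interval_category algebra_simps
       split: if_splits)

lemma members_iff: "i \<in> members M \<longleftrightarrow> snd i < count M (fst i)"
  by (cases i) (auto simp: members_def simp flip: count_greater_zero_iff)

lemma finite_members [simp]: "finite (members M)"
  by (simp add: members_def)

lemma members_empty [simp]: "members {#} = {}"
  by (auto simp: members_iff)

lemma members_singleton [simp]: "members {#x#} = {(x, 0)}"
  by (auto simp: members_iff split: if_splits)

lemma fst_members: "i \<in> members M \<Longrightarrow> fst i \<in># M"
  by (simp add: members_iff flip: count_greater_zero_iff)

lemma multiset_Hom_iff:
  "\<phi> \<in> multiset_Hom M N \<longleftrightarrow>
    (\<forall>i j. \<phi> i j = 1 \<longrightarrow> i \<in> members M \<and> j \<in> members N \<and> nonzero_Hom (fst i) (fst j))"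
proof -
  have "(if i \<in> members M \<and> j \<in> members N then \<phi> i j \<in> interval_Hom (fst i) (fst j) else \<phi> i j = 0) \<longleftrightarrow>
    (\<phi> i j = 1 \<longrightarrow> i \<in> members M \<and> j \<in> members N \<and> nonzero_Hom (fst i) (fst j))" for i j
    by (cases "\<phi> i j") (auto simp: interval_Hom_eq)
  then show ?thesis by (simp only: multiset_Hom_def mem_Collect_eq)
qed

lemma multiset_HomD:
  assumes "\<phi> \<in> multiset_Hom M N" "\<phi> i j = 1"
  shows "i \<in> members M" "j \<in> members N" "nonzero_Hom (fst i) (fst j)"
  using assms unfolding multiset_Hom_iff by blast+

lemma multiset_Comp_in_Hom:
  assumes f: "f \<in> multiset_Hom M N" and g: "g \<in> multiset_Hom N P"
  shows "multiset_Comp M N P g f \<in> multiset_Hom M P"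
  unfolding multiset_Hom_iff
proof (intro allI impI)
  fix i k assume nz: "multiset_Comp M N P g f i k = 1"
  have "\<exists>j\<in>members N. interval_Comp (fst i) (fst j) (fst k) (g j k) (f i j) \<noteq> 0"
  proof (rule ccontr)
    assume "\<not> ?thesis"
    then have "multiset_Comp M N P g f i k = 0"
      unfolding multiset_Comp_def by (intro sum.neutral) blast
    with nz show False by simp
  qed
  then obtain j where j: "j \<in> members N" "interval_Comp (fst i) (fst j) (fst k) (g j k) (f i j) = 1"
    by auto
  have "g j k \<noteq> 0" "f i j \<noteq> 0"
    using j(2) interval_Comp_0 zero_neq_one by metis+
  then have 1: "g j k = 1" "f i j = 1" by simp_all
  note fD = multiset_HomD [OF f 1(2)] and gD = multiset_HomD [OF g 1(1)]
  have "nonzero_Hom (fst i) (fst k)"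
    using j(2) fD(3) gD(3) by (simp add: interval_Comp_of_nonzero_Hom split: if_splits)
  with fD gD show "i \<in> members M \<and> k \<in> members P \<and> nonzero_Hom (fst i) (fst k)"
    by simp
qed

lemma multiset_Ident_in_Hom: "M \<in> Ob (multiset_category n) \<Longrightarrow> multiset_Ident M \<in> multiset_Hom M M"
  using fst_members[of _ M]
  by (auto simp: multiset_category_simps multiset_Hom_iff multiset_Ident_def nonzero_Hom_def Ob_interval_category subset_iff)

lemma multiset_Comp_Ident:
  assumes "M \<in> Ob (multiset_category n)" "N \<in> Ob (multiset_category n)" and f: "f \<in> multiset_Hom M N"
  shows "multiset_Comp M M N f (multiset_Ident M) = f"
    and "multiset_Comp M N N (multiset_Ident N) f = f"
proof -
  have *: "f i k = 0" if "i \<notin> members M \<or> k \<notin> members N \<or> \<not> nonzero_Hom (fst i) (fst k)" for i k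
    using multiset_HomD [OF f] that by (cases "f i k") auto
  have **: "fst (fst i) \<le> snd (fst i)" if "i \<in> members M \<or> i \<in> members N" for i
    using that assms fst_members[of i] by (auto simp: multiset_category_simps subset_iff Ob_interval_category)
  have "multiset_Comp M M N f (multiset_Ident M) i k = f i k" for i k
  proof -
    have "multiset_Comp M M N f (multiset_Ident M) i k =
      (\<Sum>j\<in>members M. if j = i then interval_Comp (fst i) (fst i) (fst k) (f i k) 1 else 0)"
      unfolding multiset_Comp_def by (rule sum.cong) (auto simp: multiset_Ident_def)
    also have "\<dots> = f i k"
      using *[of i k] **[of i] by (auto simp: interval_Comp_eq nonzero_Hom_def)
    finally show ?thesis .
  qed
  then show "multiset_Comp M M N f (multiset_Ident M) = f" by (simp add: fun_eq_iff)
  have "multiset_Comp M N N (multiset_Ident N) f i k = f i k" for i k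
  proof -
    have "multiset_Comp M N N (multiset_Ident N) f i k =
      (\<Sum>j\<in>members N. if j = k then interval_Comp (fst i) (fst k) (fst k) 1 (f i k) else 0)"
      unfolding multiset_Comp_def by (rule sum.cong) (auto simp: multiset_Ident_def)
    also have "\<dots> = f i k"
      using *[of i k] **[of k] by (auto simp: interval_Comp_eq nonzero_Hom_def)
    finally show ?thesis .
  qed
  then show "multiset_Comp M N N (multiset_Ident N) f = f" by (simp add: fun_eq_iff)
qed

lemma multiset_Comp_assoc:
  "multiset_Comp M N Q (multiset_Comp N P Q h g) f = multiset_Comp M P Q h (multiset_Comp M N P g f)"
  unfolding multiset_Comp_def fun_eq_iff interval_Comp_sum interval_Comp_assoc
  by (intro allI sum.swap)

lemma multiset_Comp_add:
  "multiset_Comp M N P (g + g') f = multiset_Comp M N P g f + multiset_Comp M N P g' f"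
  "multiset_Comp M N P g (f + f') = multiset_Comp M N P g f + multiset_Comp M N P g f'"
  unfolding multiset_Comp_def fun_eq_iff plus_fun_apply interval_Comp_add sum.distrib
  by (rule allI refl)+

lemma multiset_Comp_scale:
  "multiset_Comp M N P (matrix_scale c g) f = matrix_scale c (multiset_Comp M N P g f)"
  "multiset_Comp M N P g (matrix_scale c f) = matrix_scale c (multiset_Comp M N P g f)"
  unfolding multiset_Comp_def matrix_scale_def fun_eq_iff interval_Comp_scale sum_distrib_left
  by (rule allI refl)+

lemma zero_multiset_Hom: "0 \<in> multiset_Hom M N"
  by (simp add: multiset_Hom_iff)

lemma add_multiset_Hom: 
  assumes "f \<in> multiset_Hom M N" "g \<in> multiset_Hom M N"
  shows "f + g \<in> multiset_Hom M N"
proof -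
  have "f i j = 1 \<or> g i j = 1" if "(f + g) i j = 1" for i j
    using that by (cases "f i j") auto
  with assms show ?thesis
    unfolding multiset_Hom_iff by blast
qed

lemma uminus_interval_matrix: "- f = (f :: interval_matrix)"
  by (simp add: fun_eq_iff)

lemma category_multiset_category: "category (multiset_category n)"
  by (intro category.intro, unfold multiset_category_unfold)
    (assumption | rule multiset_Ident_in_Hom multiset_Comp_in_Hom multiset_Comp_Ident multiset_Comp_assoc)+

lemma preadditive_multiset_category: "preadditive_category (multiset_category n)"
  by (intro preadditive_category.intro preadditive_category_axioms.intro category_multiset_category,
      unfold multiset_category_unfold)
    (simp_all only: zero_multiset_Hom add_multiset_Hom uminus_interval_matrix multiset_Comp_add)

lemma linear_multiset_category: "linear_category (multiset_category n) matrix_scale"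
proof (intro linear_category.intro preadditive_multiset_category linear_category_axioms.intro)
  show "vector_space matrix_scale"
    unfolding matrix_scale_def
    by unfold_locales (simp_all only: fun_eq_iff plus_fun_apply distrib_left distrib_right mult.assoc mult_1 simp_thms)
qed (simp_all add: multiset_category_unfold multiset_Comp_scale, auto simp: multiset_Hom_iff matrix_scale_def)

section \<open>Direct sums of multisets\<close>

lemma Ob_multiset [simp]:
  "{#} \<in> Ob (multiset_category n)"
  "add_mset x M \<in> Ob (multiset_category n) \<longleftrightarrow> x \<in> Ob (interval_category n) \<and> M \<in> Ob (multiset_category n)"
  "M + N \<in> Ob (multiset_category n) \<longleftrightarrow> M \<in> Ob (multiset_category n) \<and> N \<in> Ob (multiset_category n)"
  by (simp_all add: multiset_category_simps)

lemma Ob_multiset_diff: "M \<in> Ob (multiset_category n) \<Longrightarrow> M - N \<in> Ob (multiset_category n)"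
  by (auto simp: multiset_category_simps dest: in_diffD)

lemma Ob_members:
  assumes "M \<in> Ob (multiset_category n)" "i \<in> members M"
  shows "fst i \<in> Ob (interval_category n)"
  using assms fst_members [of i M] by (auto simp: multiset_category_simps)

lemma interval_Comp_one:
  assumes "\<phi> = 1 \<Longrightarrow> nonzero_Hom x y"
  shows "interval_Comp x y y 1 \<phi> = \<phi>" "interval_Comp x x y \<phi> 1 = \<phi>"
  using assms by (cases \<phi>; auto simp: interval_Comp_eq nonzero_Hom_def)+

lemma multiset_Hom_empty [simp]: "multiset_Hom M {#} = {0}" "multiset_Hom {#} M = {0}"
proof -
  have "\<phi> = 0" if "\<forall>i j. \<phi> i j \<noteq> 1" for \<phi> :: interval_matrix
    using that by (simp add: fun_eq_iff)
  then show "multiset_Hom M {#} = {0}" "multiset_Hom {#} M = {0}"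
    by (fastforce simp: multiset_Hom_iff)+
qed

lemma finite_multiset_Hom: "finite (multiset_Hom M N)"
proof -
  have "inj_on (\<lambda>\<phi>. {(i, j). \<phi> i j = 1}) (multiset_Hom M N)"
  proof (rule inj_onI)
    fix \<phi> \<psi> :: interval_matrix
    assume "{(i, j). \<phi> i j = 1} = {(i, j). \<psi> i j = 1}"
    then have "\<phi> i j = 1 \<longleftrightarrow> \<psi> i j = 1" for i j by blast
    then show "\<phi> = \<psi>" by (metis (full_types) bit_not_one_iff ext)
  qed
  moreover have "(\<lambda>\<phi>. {(i, j). \<phi> i j = 1}) ` multiset_Hom M N \<subseteq> Pow (members M \<times> members N)"
    by (auto dest: multiset_HomD)
  then have "finite ((\<lambda>\<phi>. {(i, j). \<phi> i j = 1}) ` multiset_Hom M N)"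
    by (rule finite_subset) simp
  ultimately show ?thesis by (rule finite_imageD [rotated])
qed

definition inclusion_matrix :: "interval multiset \<Rightarrow> (interval \<times> nat \<Rightarrow> interval \<times> nat) \<Rightarrow> interval_matrix" where
  "inclusion_matrix M \<sigma> = (\<lambda>i j. of_bool (i \<in> members M \<and> j = \<sigma> i))"

definition projection_matrix :: "interval multiset \<Rightarrow> (interval \<times> nat \<Rightarrow> interval \<times> nat) \<Rightarrow> interval_matrix" where
  "projection_matrix M \<sigma> = (\<lambda>j i. of_bool (i \<in> members M \<and> j = \<sigma> i))"

text \<open>
  Members of equal intervals are told apart by a numbering, so that a summand cannot be expected to
  sit in a multiset with its own numbering; \<open>\<sigma>\<close> keeps the interval and may change the number.
\<close>

definition embeds_members where
  "embeds_members M S \<sigma> \<longleftrightarrow> inj_on \<sigma> (members M) \<and> \<sigma> ` members M \<subseteq> members S \<and> (\<forall>i\<in>members M. fst (\<sigma> i) = fst i)"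

lemma embeds_membersD:
  assumes "embeds_members M S \<sigma>"
  shows "i \<in> members M \<Longrightarrow> \<sigma> i \<in> members S" "i \<in> members M \<Longrightarrow> fst (\<sigma> i) = fst i"
    "i \<in> members M \<Longrightarrow> i' \<in> members M \<Longrightarrow> \<sigma> i = \<sigma> i' \<longleftrightarrow> i = i'"
  using assms by (auto simp: embeds_members_def inj_on_eq_iff)

lemma inclusion_matrix_in_Hom:
  assumes \<sigma>: "embeds_members M S \<sigma>" and M: "M \<in> Ob (multiset_category n)"
  shows "inclusion_matrix M \<sigma> \<in> multiset_Hom M S" "projection_matrix M \<sigma> \<in> multiset_Hom S M"
proof -
  have "nonzero_Hom (fst i) (fst i)" if "i \<in> members M" for i
    using Ob_members [OF M that] by (simp add: Ob_interval_category nonzero_Hom_def)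
  then show "inclusion_matrix M \<sigma> \<in> multiset_Hom M S" "projection_matrix M \<sigma> \<in> multiset_Hom S M"
    using embeds_membersD [OF \<sigma>]
    by (auto simp: multiset_Hom_iff inclusion_matrix_def projection_matrix_def)
qed

lemma Comp_projection_matrix:
  assumes \<sigma>: "embeds_members M S \<sigma>" and \<phi>: "\<phi> \<in> multiset_Hom X S" and j: "j \<in> members M"
  shows "multiset_Comp X S M (projection_matrix M \<sigma>) \<phi> i j = \<phi> i (\<sigma> j)"
proof -
  have "multiset_Comp X S M (projection_matrix M \<sigma>) \<phi> i j =
    (\<Sum>k\<in>members S. if k = \<sigma> j then interval_Comp (fst i) (fst k) (fst j) 1 (\<phi> i k) else 0)"
    unfolding multiset_Comp_def by (rule sum.cong) (use j in \<open>auto simp: projection_matrix_def\<close>)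
  also have "\<dots> = interval_Comp (fst i) (fst (\<sigma> j)) (fst j) 1 (\<phi> i (\<sigma> j))"
    using embeds_membersD [OF \<sigma>] j by simp
  also have "\<dots> = \<phi> i (\<sigma> j)"
    using embeds_membersD(2) [OF \<sigma> j] multiset_HomD(3) [OF \<phi>, of i "\<sigma> j"] by (simp add: interval_Comp_one)
  finally show ?thesis .
qed

lemma Comp_inclusion_matrix:
  assumes \<sigma>: "embeds_members M S \<sigma>" and \<phi>: "\<phi> \<in> multiset_Hom X M"
  shows "j \<in> members M \<Longrightarrow> multiset_Comp X M S (inclusion_matrix M \<sigma>) \<phi> i (\<sigma> j) = \<phi> i j"
    and "k \<notin> \<sigma> ` members M \<Longrightarrow> multiset_Comp X M S (inclusion_matrix M \<sigma>) \<phi> i k = 0"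
proof -
  assume j: "j \<in> members M"
  have "multiset_Comp X M S (inclusion_matrix M \<sigma>) \<phi> i (\<sigma> j) =
    (\<Sum>k\<in>members M. if k = j then interval_Comp (fst i) (fst k) (fst (\<sigma> j)) 1 (\<phi> i k) else 0)"
    unfolding multiset_Comp_def
    by (rule sum.cong) (use j embeds_membersD [OF \<sigma>] in \<open>auto simp: inclusion_matrix_def\<close>)
  also have "\<dots> = \<phi> i j"
    using embeds_membersD(2) [OF \<sigma> j] multiset_HomD(3) [OF \<phi>, of i j] j by (simp add: interval_Comp_one)
  finally show "multiset_Comp X M S (inclusion_matrix M \<sigma>) \<phi> i (\<sigma> j) = \<phi> i j" .
next
  assume "k \<notin> \<sigma> ` members M"
  then show "multiset_Comp X M S (inclusion_matrix M \<sigma>) \<phi> i k = 0"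
    unfolding multiset_Comp_def by (intro sum.neutral) (auto simp: inclusion_matrix_def)
qed

lemma multiset_Hom_ext:
  assumes "\<phi> \<in> multiset_Hom M N" "\<psi> \<in> multiset_Hom M N"
    and "\<And>i j. \<lbrakk>i \<in> members M; j \<in> members N\<rbrakk> \<Longrightarrow> \<phi> i j = \<psi> i j"
  shows "\<phi> = \<psi>"
proof (intro ext)
  fix i j show "\<phi> i j = \<psi> i j"
  proof (cases "i \<in> members M \<and> j \<in> members N")
    case False
    then show ?thesis using assms(1,2) unfolding multiset_Hom_def by auto
  qed (use assms(3) in blast)
qed

lemma biproduct_of_partition:
  assumes ob: "M \<in> Ob (multiset_category n)" "N \<in> Ob (multiset_category n)" "S \<in> Ob (multiset_category n)"
    and \<sigma>: "embeds_members M S \<sigma>" and \<tau>: "embeds_members N S \<tau>"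
    and un: "members S \<subseteq> \<sigma> ` members M \<union> \<tau> ` members N"
    and disj: "\<sigma> ` members M \<inter> \<tau> ` members N = {}"
  shows "biproduct (multiset_category n) M N S
    (inclusion_matrix M \<sigma>) (inclusion_matrix N \<tau>) (projection_matrix M \<sigma>) (projection_matrix N \<tau>)"
proof -
  note H = inclusion_matrix_in_Hom [OF \<sigma> ob(1)] inclusion_matrix_in_Hom [OF \<tau> ob(2)]
  note I = multiset_Ident_in_Hom [OF ob(1)] multiset_Ident_in_Hom [OF ob(2)] multiset_Ident_in_Hom [OF ob(3)]
  have d: "\<sigma> i \<noteq> \<tau> j" if "i \<in> members M" "j \<in> members N" for i j
    using disj that by blast
  have 1: "multiset_Comp M S M (projection_matrix M \<sigma>) (inclusion_matrix M \<sigma>) = multiset_Ident M"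
    by (rule multiset_Hom_ext [OF multiset_Comp_in_Hom [OF H(1,2)] I(1)])
      (simp only: Comp_projection_matrix [OF \<sigma> H(1)],
       auto simp: inclusion_matrix_def multiset_Ident_def embeds_membersD(3) [OF \<sigma>])
  have 2: "multiset_Comp N S N (projection_matrix N \<tau>) (inclusion_matrix N \<tau>) = multiset_Ident N"
    by (rule multiset_Hom_ext [OF multiset_Comp_in_Hom [OF H(3,4)] I(2)])
      (simp only: Comp_projection_matrix [OF \<tau> H(3)],
       auto simp: inclusion_matrix_def multiset_Ident_def embeds_membersD(3) [OF \<tau>])
  have 3: "multiset_Comp N S M (projection_matrix M \<sigma>) (inclusion_matrix N \<tau>) = 0"
    by (rule multiset_Hom_ext [OF multiset_Comp_in_Hom [OF H(3,2)] zero_multiset_Hom])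
      (simp only: Comp_projection_matrix [OF \<sigma> H(3)], simp add: inclusion_matrix_def d)
  have 4: "multiset_Comp M S N (projection_matrix N \<tau>) (inclusion_matrix M \<sigma>) = 0"
    by (rule multiset_Hom_ext [OF multiset_Comp_in_Hom [OF H(1,4)] zero_multiset_Hom])
      (simp only: Comp_projection_matrix [OF \<tau> H(1)], simp add: inclusion_matrix_def d [symmetric])
  have 5: "multiset_Comp S M S (inclusion_matrix M \<sigma>) (projection_matrix M \<sigma>) +
      multiset_Comp S N S (inclusion_matrix N \<tau>) (projection_matrix N \<tau>) = multiset_Ident S"
  proof (rule multiset_Hom_ext [of _ S S])
    fix i k assume i: "i \<in> members S" and "k \<in> members S"
    then consider j where "j \<in> members M" "k = \<sigma> j" | j where "j \<in> members N" "k = \<tau> j"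
      using un by blast
    then show "(multiset_Comp S M S (inclusion_matrix M \<sigma>) (projection_matrix M \<sigma>) +
      multiset_Comp S N S (inclusion_matrix N \<tau>) (projection_matrix N \<tau>)) i k = multiset_Ident S i k"
    proof cases
      case 1
      then have "\<sigma> j \<notin> \<tau> ` members N" using d by blast
      with 1 have "(multiset_Comp S M S (inclusion_matrix M \<sigma>) (projection_matrix M \<sigma>) +
          multiset_Comp S N S (inclusion_matrix N \<tau>) (projection_matrix N \<tau>)) i k = projection_matrix M \<sigma> i j"
        by (simp add: Comp_inclusion_matrix [OF \<sigma> H(2)] Comp_inclusion_matrix [OF \<tau> H(4)])
      with 1 i show ?thesis by (simp add: projection_matrix_def multiset_Ident_def)
    next
      case 2
      then have "\<tau> j \<notin> \<sigma> ` members M" using d by (metis imageE)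
      with 2 have "(multiset_Comp S M S (inclusion_matrix M \<sigma>) (projection_matrix M \<sigma>) +
          multiset_Comp S N S (inclusion_matrix N \<tau>) (projection_matrix N \<tau>)) i k = projection_matrix N \<tau> i j"
        by (simp add: Comp_inclusion_matrix [OF \<sigma> H(2)] Comp_inclusion_matrix [OF \<tau> H(4)])
      with 2 i show ?thesis by (simp add: projection_matrix_def multiset_Ident_def)
    qed
  qed (intro add_multiset_Hom multiset_Comp_in_Hom H I)+
  show ?thesis
    unfolding biproduct_def multiset_category_unfold using ob H 1 2 3 4 5 by blast
qed

lemma embeds_members_id: "embeds_members M (M + N) (\<lambda>i. i)"
  by (auto simp: embeds_members_def members_iff)

lemma biproduct_sum:
  assumes "M \<in> Ob (multiset_category n)" "N \<in> Ob (multiset_category n)"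
  shows "\<exists>i1 i2 p1 p2. biproduct (multiset_category n) M N (M + N) i1 i2 p1 p2"
proof -
  define \<tau> :: "interval \<times> nat \<Rightarrow> interval \<times> nat" where "\<tau> = (\<lambda>i. (fst i, snd i + count M (fst i)))"
  have \<tau>: "embeds_members N (M + N) \<tau>"
    by (auto simp: embeds_members_def members_iff \<tau>_def inj_on_def prod_eq_iff)
  have "i \<in> \<tau> ` members N" if "i \<in> members (M + N)" "i \<notin> members M" for i
  proof (rule image_eqI)
    show "i = \<tau> (fst i, snd i - count M (fst i))" "(fst i, snd i - count M (fst i)) \<in> members N"
      using that by (auto simp: \<tau>_def members_iff prod_eq_iff)
  qed
  moreover have "members M \<inter> \<tau> ` members N = {}"
    by (auto simp: members_iff \<tau>_def)
  ultimately show ?thesis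
    using biproduct_of_partition [of M n N "M + N" "\<lambda>i. i" \<tau>] assms embeds_members_id \<tau> by fastforce
qed

text \<open>
  Any chosen member \<open>j\<close> of a multiset spans a direct summand.  The complement is numbered like
  \<open>N - {#fst j#}\<close>, from which the last copy \<open>e\<close> of the interval of \<open>j\<close> is missing, so \<open>\<sigma>\<close> moves \<open>j\<close> to \<open>e\<close>.
\<close>

lemma biproduct_split_off:
  assumes N: "N \<in> Ob (multiset_category n)" and j: "j \<in> members N"
  obtains \<sigma> where "embeds_members (N - {#fst j#}) N \<sigma>" "embeds_members {#fst j#} N (\<lambda>_. j)"
    "biproduct (multiset_category n) (N - {#fst j#}) {#fst j#} N
      (inclusion_matrix (N - {#fst j#}) \<sigma>) (inclusion_matrix {#fst j#} (\<lambda>_. j))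
      (projection_matrix (N - {#fst j#}) \<sigma>) (projection_matrix {#fst j#} (\<lambda>_. j))"
proof -
  define N0 where "N0 = N - {#fst j#}"
  define e where "e = (fst j, count N (fst j) - 1)"
  define \<sigma> where "\<sigma> = (\<lambda>i. if i = j then e else i)"
  have e: "e \<in> members N" using j by (auto simp: e_def members_iff)
  have N0: "members N0 = members N - {e}"
  proof (rule set_eqI)
    fix i show "i \<in> members N0 \<longleftrightarrow> i \<in> members N - {e}"
      using j by (cases "fst i = fst j") (auto simp: N0_def e_def members_iff prod_eq_iff[of i])
  qed
  have \<sigma>: "embeds_members N0 N \<sigma>"
    unfolding embeds_members_def N0 using e by (auto simp: \<sigma>_def inj_on_def e_def)
  have \<tau>: "embeds_members {#fst j#} N (\<lambda>_. j)"
    using j by (simp add: embeds_members_def)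
  have im: "\<sigma> ` members N0 = members N - {j}"
  proof (intro equalityI subsetI)
    fix i assume "i \<in> members N - {j}"
    then show "i \<in> \<sigma> ` members N0"
      using j unfolding N0 by (cases "i = e") (auto simp: \<sigma>_def intro: rev_image_eqI [of j])
  qed (use e in \<open>auto simp: N0 \<sigma>_def split: if_splits\<close>)
  have "biproduct (multiset_category n) N0 {#fst j#} N
      (inclusion_matrix N0 \<sigma>) (inclusion_matrix {#fst j#} (\<lambda>_. j))
      (projection_matrix N0 \<sigma>) (projection_matrix {#fst j#} (\<lambda>_. j))"
    by (rule biproduct_of_partition)
      (use N \<sigma> \<tau> im Ob_members [OF N j] Ob_multiset_diff [OF N] in \<open>auto simp: N0_def\<close>)
  with \<sigma> \<tau> that show thesis by (simp add: N0_def)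
qed

section \<open>Morphisms from and to intervals\<close>

abbreviation arrow :: "interval \<Rightarrow> interval \<Rightarrow> interval_matrix" where
  "arrow x y \<equiv> singleton_matrix x y 1"

lemma multiset_Hom_singletons:
  "multiset_Hom {#x#} {#y#} = (if nonzero_Hom x y then {0, arrow x y} else {0})"
proof -
  have "\<phi> = (if \<phi> (x, 0) (y, 0) = 1 then arrow x y else 0)" if "\<phi> \<in> multiset_Hom {#x#} {#y#}" for \<phi>
  proof (rule multiset_Hom_ext [OF that])
    show "(if \<phi> (x, 0) (y, 0) = 1 then arrow x y else 0) \<in> multiset_Hom {#x#} {#y#}"
      using multiset_HomD(3) [OF that, of "(x, 0)" "(y, 0)"]
      by (auto simp: multiset_Hom_iff singleton_matrix_def)
  qed (auto simp: singleton_matrix_def)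
  moreover have "nonzero_Hom x y" if "\<phi> \<in> multiset_Hom {#x#} {#y#}" "\<phi> (x, 0) (y, 0) = 1" for \<phi>
    using multiset_HomD(3) [OF that] by simp
  moreover have "arrow x y \<in> multiset_Hom {#x#} {#y#}" if "nonzero_Hom x y"
    using that by (auto simp: multiset_Hom_iff singleton_matrix_def)
  ultimately have "\<phi> \<in> multiset_Hom {#x#} {#y#} \<longleftrightarrow> \<phi> = 0 \<or> nonzero_Hom x y \<and> \<phi> = arrow x y" for \<phi>
    using zero_multiset_Hom by metis
  then show ?thesis by auto
qed

lemma arrow_nonzero [simp]: "arrow x y \<noteq> 0"
  by (auto simp: singleton_matrix_def fun_eq_iff)

lemma arrow_in_Hom: "nonzero_Hom x y \<Longrightarrow> arrow x y \<in> multiset_Hom {#x#} {#y#}"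
  by (simp add: multiset_Hom_singletons)

lemma Comp_arrow_right:
  assumes "nonzero_Hom x y" and u: "u \<in> multiset_Hom {#y#} w"
  shows "multiset_Comp {#x#} {#y#} w u (arrow x y) =
    (\<lambda>i k. if i = (x, 0) \<and> nonzero_Hom x (fst k) then u (y, 0) k else 0)"
proof (intro ext)
  fix i k
  show "multiset_Comp {#x#} {#y#} w u (arrow x y) i k =
      (if i = (x, 0) \<and> nonzero_Hom x (fst k) then u (y, 0) k else 0)"
    using assms(1) multiset_HomD(3) [OF u, of "(y, 0)" k]
    by (cases "u (y, 0) k") (auto simp: multiset_Comp_def singleton_matrix_def interval_Comp_of_nonzero_Hom)
qed

lemma Comp_arrow_left:
  assumes "nonzero_Hom x y" and u: "u \<in> multiset_Hom w {#x#}"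
  shows "multiset_Comp w {#x#} {#y#} (arrow x y) u =
    (\<lambda>k j. if j = (y, 0) \<and> nonzero_Hom (fst k) y then u k (x, 0) else 0)"
proof (intro ext)
  fix k j
  show "multiset_Comp w {#x#} {#y#} (arrow x y) u k j =
      (if j = (y, 0) \<and> nonzero_Hom (fst k) y then u k (x, 0) else 0)"
    using assms(1) multiset_HomD(3) [OF u, of k "(x, 0)"]
    by (cases "u k (x, 0)") (auto simp: multiset_Comp_def singleton_matrix_def interval_Comp_of_nonzero_Hom)
qed

lemma Comp_arrow_arrow:
  assumes "nonzero_Hom x y" "nonzero_Hom y z"
  shows "multiset_Comp {#x#} {#y#} {#z#} (arrow y z) (arrow x y) = (if nonzero_Hom x z then arrow x z else 0)"
  unfolding Comp_arrow_right [OF assms(1) arrow_in_Hom [OF assms(2)]]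
  by (auto simp: singleton_matrix_def fun_eq_iff)

lemma nonzero_Hom_Pair [simp]: "nonzero_Hom (a, b) (c, d) \<longleftrightarrow> a \<le> c \<and> c \<le> b \<and> b \<le> d"
  by (auto simp: nonzero_Hom_def)

text \<open>
  The interval $[c,b]$ is the cokernel of $[a,c-1] \to [a,b]$: if a non-zero entry of \<open>u\<close> goes to
  $[e,f]$ with $e < c$, then its restriction to $[a,c-1]$ is non-zero as well.  The guard
  $a < c$ is there because $[a,c-1]$ is empty for $a = c$.
\<close>

lemma factor_through_quotient:
  assumes c: "a \<le> c" "c \<le> b" and u: "u \<in> multiset_Hom {#(a, b)#} w"
    and 0: "a < c \<Longrightarrow> multiset_Comp {#(a, c - 1)#} {#(a, b)#} w u (arrow (a, c - 1) (a, b)) = 0"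
  obtains u' where "u' \<in> multiset_Hom {#(c, b)#} w"
    "multiset_Comp {#(a, b)#} {#(c, b)#} w u' (arrow (a, b) (c, b)) = u"
proof
  define u' :: interval_matrix where "u' = (\<lambda>i k. if i = ((c, b), 0) then u ((a, b), 0) k else 0)"
  have nz: "nonzero_Hom (c, b) (fst k)" "nonzero_Hom (a, b) (fst k)" if k: "u ((a, b), 0) k = 1" for k
  proof -
    obtain e f where ef: "fst k = (e, f)" by (cases "fst k")
    have *: "a \<le> e" "e \<le> b" "b \<le> f" using multiset_HomD(3) [OF u k] ef by auto
    have "c \<le> e"
    proof (rule ccontr)
      assume "\<not> c \<le> e"
      with * have "a < c" "nonzero_Hom (a, c - 1) (a, b)" "nonzero_Hom (a, c - 1) (fst k)"
        using c by (auto simp: ef)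
      then show False
        using fun_cong [OF fun_cong [OF 0, of "((a, c - 1), 0)"], of k] k
        by (simp add: Comp_arrow_right [OF _ u])
    qed
    with * ef show "nonzero_Hom (c, b) (fst k)" "nonzero_Hom (a, b) (fst k)" by auto
  qed
  show u': "u' \<in> multiset_Hom {#(c, b)#} w"
    using nz multiset_HomD(2) [OF u] by (auto simp: multiset_Hom_iff u'_def)
  show "multiset_Comp {#(a, b)#} {#(c, b)#} w u' (arrow (a, b) (c, b)) = u"
  proof (rule multiset_Hom_ext [OF multiset_Comp_in_Hom [OF arrow_in_Hom u'] u])
    fix i k assume "i \<in> members {#(a, b)#}"
    then show "multiset_Comp {#(a, b)#} {#(c, b)#} w u' (arrow (a, b) (c, b)) i k = u i k"
      using c nz [of k] by (cases "u ((a, b), 0) k") (simp_all add: Comp_arrow_right [OF _ u'], simp_all add: u'_def)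
  qed (use c in auto)
qed

text \<open>
  The non-zero entries of \<open>u\<close> go to intervals $[t,d']$, and $[t,d]$ maps to each of those with
  $d \le d'$.
\<close>

lemma extend_along_inclusion:
  assumes t: "t \<le> d" and u: "u \<in> multiset_Hom {#(t, t)#} w"
    and d: "\<And>k. u ((t, t), 0) k = 1 \<Longrightarrow> d \<le> snd (fst k)"
  obtains r where "r \<in> multiset_Hom {#(t, d)#} w"
    "multiset_Comp {#(t, t)#} {#(t, d)#} w r (arrow (t, t) (t, d)) = u"
proof
  define r :: interval_matrix where "r = (\<lambda>i k. if i = ((t, d), 0) then u ((t, t), 0) k else 0)"
  have nz: "nonzero_Hom (t, d) (fst k)" "nonzero_Hom (t, t) (fst k)" if k: "u ((t, t), 0) k = 1" for k
    using multiset_HomD(3) [OF u k] d [OF k] t by (auto simp: nonzero_Hom_def)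
  show r: "r \<in> multiset_Hom {#(t, d)#} w"
    using nz multiset_HomD(2) [OF u] by (auto simp: multiset_Hom_iff r_def)
  show "multiset_Comp {#(t, t)#} {#(t, d)#} w r (arrow (t, t) (t, d)) = u"
  proof (rule multiset_Hom_ext [OF multiset_Comp_in_Hom [OF arrow_in_Hom r] u])
    fix i k assume "i \<in> members {#(t, t)#}"
    then show "multiset_Comp {#(t, t)#} {#(t, d)#} w r (arrow (t, t) (t, d)) i k = u i k"
      using t nz [of k] by (cases "u ((t, t), 0) k") (simp_all add: Comp_arrow_right [OF _ r], simp_all add: r_def)
  qed (use t in auto)
qed

section \<open>Elements and cokernels\<close>

text \<open>
  The objects \<open>projective t\<close> are the test objects that define elements; \<open>simple t\<close> is the quotient of
  \<open>projective t\<close> by \<open>projective (t - 1)\<close>, and equals \<open>projective t\<close> for \<open>t = 1\<close>.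
\<close>

locale interval_multisets =
  fixes n :: nat
begin

abbreviation A where "A \<equiv> multiset_category n"

sublocale preadditive_category A
  by (rule preadditive_multiset_category)

definition projective :: "int \<Rightarrow> interval multiset" where "projective t = {#(1, t)#}"

definition simple :: "int \<Rightarrow> interval multiset" where "simple t = {#(t, t)#}"

definition projectives :: "interval multiset set" where "projectives = projective ` {1..int n}"

lemma Ob_projective [simp]: "projective t \<in> Ob A \<longleftrightarrow> 1 \<le> t \<and> t \<le> int n"
  and Ob_simple [simp]: "simple t \<in> Ob A \<longleftrightarrow> 1 \<le> t \<and> t \<le> int n"
  by (auto simp: projective_def simple_def)

lemma projectives_Ob: "projectives \<subseteq> Ob A"
  by (auto simp: projectives_def)

lemma arrow_in [simp]: "nonzero_Hom x y \<Longrightarrow> arrow x y \<in> Hom A {#x#} {#y#}"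
  by (simp add: multiset_category_unfold arrow_in_Hom)

lemma Comp_arrows [simp]:
  assumes "nonzero_Hom x y" "nonzero_Hom y z"
  shows "Comp A {#x#} {#y#} {#z#} (arrow y z) (arrow x y) = (if nonzero_Hom x z then arrow x z else 0)"
  using Comp_arrow_arrow [OF assms] by (simp add: multiset_category_unfold)

lemma Hom_singletons: "Hom A {#x#} {#y#} = (if nonzero_Hom x y then {0, arrow x y} else {0})"
  by (simp add: multiset_category_unfold multiset_Hom_singletons)

lemma arrow_refl: "arrow x x = Ident A {#x#}"
  by (auto simp: multiset_category_unfold singleton_matrix_def multiset_Ident_def fun_eq_iff)

lemma Hom_empty [simp]: "Hom A M {#} = {0}" "Hom A {#} M = {0}"
  by (simp_all add: multiset_category_unfold)

lemma epic_arrow: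
  assumes ob: "(a, b) \<in> Ob (interval_category n)" and c: "a \<le> c" "c \<le> b"
  shows "is_epic A {#(a, b)#} {#(c, b)#} (arrow (a, b) (c, b))"
proof (rule is_epicI)
  fix z g assume z: "z \<in> Ob A" "g \<in> Hom A {#(c, b)#} z"
    and 0: "Comp A {#(a, b)#} {#(c, b)#} z g (arrow (a, b) (c, b)) = 0"
  have g: "g \<in> multiset_Hom {#(c, b)#} z" using z by (simp add: multiset_category_unfold)
  have nz: "nonzero_Hom (a, b) (c, b)" using c by simp
  have "g ((c, b), 0) k \<noteq> 1" for k
  proof
    assume k: "g ((c, b), 0) k = 1"
    then have "nonzero_Hom (a, b) (fst k)"
      using multiset_HomD(3) [OF g k] c by (auto simp: nonzero_Hom_def)
    then show False
      using fun_cong [OF fun_cong [OF 0, of "((a, b), 0)"], of k] k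
      by (simp add: multiset_category_unfold Comp_arrow_right [OF nz g])
  qed
  then show "g = 0"
    by (intro multiset_Hom_ext [OF g zero_multiset_Hom]) auto
qed (use assms in auto)

lemma monic_arrow:
  assumes ob: "(a, d) \<in> Ob (interval_category n)" and b: "a \<le> b" "b \<le> d"
  shows "is_monic A {#(a, b)#} {#(a, d)#} (arrow (a, b) (a, d))"
proof (rule is_monicI)
  fix w g assume z: "w \<in> Ob A" "g \<in> Hom A w {#(a, b)#}"
    and 0: "Comp A w {#(a, b)#} {#(a, d)#} (arrow (a, b) (a, d)) g = 0"
  have g: "g \<in> multiset_Hom w {#(a, b)#}" using z by (simp add: multiset_category_unfold)
  have nz: "nonzero_Hom (a, b) (a, d)" using b by simp
  have "g k ((a, b), 0) \<noteq> 1" for k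
  proof
    assume k: "g k ((a, b), 0) = 1"
    then have "nonzero_Hom (fst k) (a, d)"
      using multiset_HomD(3) [OF g k] b by (auto simp: nonzero_Hom_def)
    then show False
      using fun_cong [OF fun_cong [OF 0, of k], of "((a, d), 0)"] k
      by (simp add: multiset_category_unfold Comp_arrow_left [OF nz g])
  qed
  then show "g = 0"
    by (intro multiset_Hom_ext [OF g zero_multiset_Hom]) auto
qed (use assms in auto)

text \<open>
  The quotient of $[t,d]$ by its bottom $[t,t]$ is $[t+1,d]$, or zero for $t = d$.
\<close>

lemma exact_cokernel_bottom:
  assumes t: "1 \<le> t" "t \<le> d" "d \<le> int n"
  shows "\<exists>Y \<rho>. exact_cokernel A projectives (simple t) {#(t, d)#} (arrow (t, t) (t, d)) Y \<rho>"
proof (cases "t = d")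
  case True
  have "exact_cokernel A projectives (simple t) {#(t, d)#} (Ident A (simple t)) {#} 0"
    unfolding exact_cokernel_def True simple_def
  proof (intro conjI ballI impI)
    show "is_cokernel A {#(d, d)#} {#(d, d)#} (Ident A {#(d, d)#}) {#} 0"
      by (rule is_cokernelI) (use t True in \<open>auto intro!: is_epicI\<close>)
  next
    fix p v assume "p \<in> projectives" "v \<in> Hom A p {#(d, d)#}"
    then show "\<exists>u\<in>Hom A p {#(d, d)#}. Comp A p {#(d, d)#} {#(d, d)#} (Ident A {#(d, d)#}) u = v"
      using projectives_Ob t True by (intro bexI [of _ v]) auto
  next
    fix p w assume "p \<in> projectives" "w \<in> Hom A p {#}"
    then show "\<exists>v\<in>Hom A p {#(d, d)#}. Comp A p {#(d, d)#} {#} 0 v = w"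
      using projectives_Ob t True by (intro bexI [of _ 0]) auto
  qed
  then show ?thesis using True by (auto simp: arrow_refl simple_def)
next
  case False
  then have td: "t < d" using t by simp
  have "exact_cokernel A projectives (simple t) {#(t, d)#} (arrow (t, t) (t, d)) {#(t + 1, d)#} (arrow (t, d) (t + 1, d))"
    unfolding exact_cokernel_def simple_def
  proof (intro conjI ballI impI)
    show "is_cokernel A {#(t, t)#} {#(t, d)#} (arrow (t, t) (t, d)) {#(t + 1, d)#} (arrow (t, d) (t + 1, d))"
    proof (rule is_cokernelI)
      show "is_epic A {#(t, d)#} {#(t + 1, d)#} (arrow (t, d) (t + 1, d))"
        using t td by (intro epic_arrow) auto
      fix w g assume g: "g \<in> Hom A {#(t, d)#} w" "Comp A {#(t, t)#} {#(t, d)#} w g (arrow (t, t) (t, d)) = 0"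
      show "\<exists>h\<in>Hom A {#(t + 1, d)#} w. Comp A {#(t, d)#} {#(t + 1, d)#} w h (arrow (t, d) (t + 1, d)) = g"
        by (rule factor_through_quotient [of t "t + 1" d g w]) (use g td in \<open>auto simp: multiset_category_unfold\<close>)
    qed (use t td in auto)
  next
    fix p v assume p: "p \<in> projectives" and v: "v \<in> Hom A p {#(t, d)#}"
      and 0: "Comp A p {#(t, d)#} {#(t + 1, d)#} (arrow (t, d) (t + 1, d)) v = 0"
    obtain r where r: "p = projective r" "1 \<le> r" "r \<le> int n" using p by (auto simp: projectives_def)
    show "\<exists>u\<in>Hom A p {#(t, t)#}. Comp A p {#(t, t)#} {#(t, d)#} (arrow (t, t) (t, d)) u = v"
    proof (cases "v = 0")
      case True
      then show ?thesis using t td r by (intro bexI [of _ 0]) auto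
    next
      case False
      then have v': "v = arrow (1, r) (t, d)" "t \<le> r" "r \<le> d"
        using v by (auto simp: r projective_def Hom_singletons split: if_splits)
      then have "r = t" using 0 td t by (auto simp: r projective_def split: if_splits)
      then show ?thesis using t td v' r by (intro bexI [of _ "arrow (1, t) (t, t)"]) (auto simp: projective_def)
    qed
  next
    fix p w assume p: "p \<in> projectives" and w: "w \<in> Hom A p {#(t + 1, d)#}"
    obtain r where r: "p = projective r" "1 \<le> r" "r \<le> int n" using p by (auto simp: projectives_def)
    show "\<exists>v\<in>Hom A p {#(t, d)#}. Comp A p {#(t, d)#} {#(t + 1, d)#} (arrow (t, d) (t + 1, d)) v = w"
    proof (cases "w = 0")
      case True
      then show ?thesis using t td r by (intro bexI [of _ 0]) auto
    next
      case False
      then have "w = arrow (1, r) (t + 1, d)" "t + 1 \<le> r" "r \<le> d"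
        using w by (auto simp: r projective_def Hom_singletons split: if_splits)
      then show ?thesis using t td r by (intro bexI [of _ "arrow (1, r) (t, d)"]) (auto simp: projective_def)
    qed
  qed
  then show ?thesis by blast
qed

text \<open>
  The interval $[t,d]$ with the least \<open>d\<close> among the targets of non-zero entries of \<open>s\<close> is split off.
  By minimality the other entries extend to it, which reduces the cokernel to that of the inclusion
  of $[t,t]$ in $[t,d]$.  This inclusion is a component of \<open>s\<close> and monic, so \<open>s\<close> is monic.
\<close>

lemma exact_cokernel_socle:
  assumes t: "1 \<le> t" "t \<le> int n" and N: "N \<in> Ob A" and s: "s \<in> Hom A (simple t) N" "s \<noteq> 0"
  shows "is_monic A (simple t) N s" "\<exists>N' q. exact_cokernel A projectives (simple t) N s N' q"
proof -
  have s': "s \<in> multiset_Hom {#(t, t)#} N" using s by (simp add: multiset_category_unfold simple_def)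
  define J where "J = {j \<in> members N. s ((t, t), 0) j = 1}"
  have "J \<noteq> {}"
  proof
    assume "J = {}"
    then have "s = 0"
      by (intro multiset_Hom_ext [OF s' zero_multiset_Hom]) (auto simp: J_def)
    with s show False by simp
  qed
  moreover have "finite J" by (simp add: J_def)
  ultimately obtain j where jJ: "j \<in> J" and jmin: "\<And>k. k \<in> J \<Longrightarrow> snd (fst j) \<le> snd (fst k)"
    using arg_min_if_finite(1) [of J "\<lambda>j. snd (fst j)"] arg_min_least [of J _ "\<lambda>j. snd (fst j)"] by metis
  define d where "d = snd (fst j)"
  have j: "j \<in> members N" "s ((t, t), 0) j = 1" using jJ by (auto simp: J_def)
  have td: "fst j = (t, d)" "t \<le> d"
    using multiset_HomD(3) [OF s' j(2)] by (auto simp: d_def nonzero_Hom_def prod_eq_iff)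
  have dn: "d \<le> int n" using Ob_members [OF N j(1)] by (simp add: td)
  define N0 where "N0 = N - {#(t, d)#}"
  obtain \<sigma> where \<sigma>: "embeds_members N0 N \<sigma>" and \<tau>: "embeds_members {#(t, d)#} N (\<lambda>_. j)"
    and b: "biproduct A N0 {#(t, d)#} N
      (inclusion_matrix N0 \<sigma>) (inclusion_matrix {#(t, d)#} (\<lambda>_. j))
      (projection_matrix N0 \<sigma>) (projection_matrix {#(t, d)#} (\<lambda>_. j))"
    using biproduct_split_off [OF N j(1)] unfolding td N0_def by blast
  note bD = biproductD [OF b]
  have p2s: "Comp A (simple t) N {#(t, d)#} (projection_matrix {#(t, d)#} (\<lambda>_. j)) s = arrow (t, t) (t, d)"
    unfolding simple_def multiset_category_unfold
  proof (rule multiset_Hom_ext [of _ "{#(t, t)#}" "{#(t, d)#}"])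
    fix i k assume "i \<in> members {#(t, t)#}" "k \<in> members {#(t, d)#}"
    then show "multiset_Comp {#(t, t)#} N {#(t, d)#} (projection_matrix {#(t, d)#} (\<lambda>_. j)) s i k = arrow (t, t) (t, d) i k"
      using Comp_projection_matrix [OF \<tau> s', of k i] j by (simp add: singleton_matrix_def)
  next
    show "multiset_Comp {#(t, t)#} N {#(t, d)#} (projection_matrix {#(t, d)#} (\<lambda>_. j)) s \<in> multiset_Hom {#(t, t)#} {#(t, d)#}"
      using bD(7) s' by (intro multiset_Comp_in_Hom) (auto simp: multiset_category_unfold)
    show "arrow (t, t) (t, d) \<in> multiset_Hom {#(t, t)#} {#(t, d)#}"
      using td by (intro arrow_in_Hom) auto
  qed
  define s1 where "s1 = Comp A (simple t) N N0 (projection_matrix N0 \<sigma>) s"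
  have s1: "s1 \<in> multiset_Hom {#(t, t)#} N0"
    unfolding s1_def simple_def multiset_category_unfold using bD(6) s' by (intro multiset_Comp_in_Hom) (auto simp: multiset_category_unfold)
  have "d \<le> snd (fst k)" if k: "s1 ((t, t), 0) k = 1" for k
  proof -
    have kN: "k \<in> members N0" using multiset_HomD(2) [OF s1 k] .
    then have "s ((t, t), 0) (\<sigma> k) = 1"
      using k Comp_projection_matrix [OF \<sigma> s' kN] by (simp add: s1_def simple_def multiset_category_unfold)
    then have "\<sigma> k \<in> J" using embeds_membersD(1) [OF \<sigma> kN] by (simp add: J_def)
    then show ?thesis using jmin [of "\<sigma> k"] embeds_membersD(2) [OF \<sigma> kN] by (simp add: d_def)
  qed
  then obtain r where r: "r \<in> multiset_Hom {#(t, d)#} N0"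
    and r': "multiset_Comp {#(t, t)#} {#(t, d)#} N0 r (arrow (t, t) (t, d)) = s1"
    using extend_along_inclusion [OF td(2) s1] by blast
  show "is_monic A (simple t) N s"
  proof (rule is_monicI)
    fix w g assume w: "w \<in> Ob A" "g \<in> Hom A w (simple t)" "Comp A w (simple t) N s g = 0"
    have "Comp A w (simple t) {#(t, d)#} (arrow (t, t) (t, d)) g = Comp A w N {#(t, d)#} (projection_matrix {#(t, d)#} (\<lambda>_. j)) (Comp A w (simple t) N s g)"
      unfolding p2s [symmetric] by (rule Comp_assoc) (use w t N s bD in auto)
    also have "\<dots> = 0" using w bD by simp
    finally show "g = 0"
      using monic_zeroD [OF monic_arrow [of t d t], of w g] w t td dn by (simp add: simple_def)
  qed (use N t s in auto)
  obtain Y \<rho> where Y: "exact_cokernel A projectives (simple t) {#(t, d)#} (arrow (t, t) (t, d)) Y \<rho>"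
    using exact_cokernel_bottom [OF t(1) td(2) dn] by blast
  obtain j1 j2 o1 o2 where b': "biproduct A N0 Y (N0 + Y) j1 j2 o1 o2"
    using biproduct_sum [of N0 n Y] bD(1) exact_cokernelD(2) [OF Y] by blast
  show "\<exists>N' q. exact_cokernel A projectives (simple t) N s N' q"
    using exact_cokernel_of_summand [OF projectives_Ob b b' _ s(1) _ p2s _ Y, of r] t r r'
    by (auto simp: multiset_category_unfold s1_def simple_def)
qed

text \<open>
  An element of $[t,t]$ other than 0 has degree \<open>t\<close>, where \<open>projective t\<close> has one as well.
\<close>

lemma lift_to_projective:
  assumes t: "1 \<le> t" "t \<le> int n" and p: "p \<in> projectives" and c: "c \<in> Hom A p (simple t)"
  shows "\<exists>c'\<in>Hom A p (projective t). Comp A p (projective t) (simple t) (arrow (1, t) (t, t)) c' = c"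
proof -
  obtain r where r: "p = projective r" "1 \<le> r" "r \<le> int n" using p by (auto simp: projectives_def)
  show ?thesis
  proof (cases "c = 0")
    case True
    then show ?thesis using t r by (intro bexI [of _ 0]) (auto simp: projective_def simple_def)
  next
    case False
    then have "c = arrow (1, r) (t, t)" "r = t"
      using c by (auto simp: r projective_def simple_def Hom_singletons split: if_splits)
    then show ?thesis using t r by (intro bexI [of _ "arrow (1, r) (1, t)"]) (auto simp: projective_def simple_def)
  qed
qed

lemma epic_projective_simple: "\<lbrakk>1 \<le> t; t \<le> int n\<rbrakk> \<Longrightarrow> is_epic A (projective t) (simple t) (arrow (1, t) (t, t))"
  unfolding projective_def simple_def by (rule epic_arrow) auto

text \<open>
  A non-zero entry of \<open>f\<close> from $[a,b]$ to $[c,d]$ has $c \le b \le d$, so it is seen in degree \<open>b\<close>, by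
  the element $[1,b] \to [a,b]$.
\<close>

lemma nonzero_on_projective:
  assumes ob: "M \<in> Ob A" "N \<in> Ob A" and f: "f \<in> Hom A M N" "f \<noteq> 0"
  obtains t x where "1 \<le> t" "t \<le> int n" "x \<in> Hom A (projective t) M" "Comp A (projective t) M N f x \<noteq> 0"
proof -
  have f': "f \<in> multiset_Hom M N" using f by (simp add: multiset_category_unfold)
  obtain i j where ij: "f i j = 1"
  proof (rule ccontr)
    assume "\<not> thesis"
    then have "f i j \<noteq> 1" for i j using that by blast
    then have "f = 0" by (intro multiset_Hom_ext [OF f' zero_multiset_Hom]) simp
    with f(2) show False by simp
  qed
  note fD = multiset_HomD [OF f' ij]
  obtain a b where ab: "fst i = (a, b)" by (cases "fst i")
  have b: "1 \<le> a" "a \<le> b" "b \<le> int n" using Ob_members [OF ob(1) fD(1)] by (auto simp: ab)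
  define x where "x = inclusion_matrix {#fst i#} (\<lambda>_. i)"
  have i: "embeds_members {#fst i#} M (\<lambda>_. i)" using fD(1) by (simp add: embeds_members_def)
  have x: "x \<in> Hom A {#fst i#} M"
    using inclusion_matrix_in_Hom [OF i, of n] ob(1) Ob_members [OF ob(1) fD(1)] by (simp add: multiset_category_unfold x_def)
  define y where "y = Comp A (projective b) {#fst i#} M x (arrow (1, b) (a, b))"
  have y: "y \<in> Hom A (projective b) M"
    unfolding y_def using b ob x arrow_in [of "(1, b)" "(a, b)"] by (intro in_Hom) (auto simp: ab projective_def)
  have a: "arrow (1, b) (a, b) \<in> multiset_Hom (projective b) {#fst i#}"
    using b by (simp add: ab projective_def arrow_in_Hom)
  have y1: "y ((1, b), 0) k = of_bool (k = i)" for k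
  proof (cases "k = i")
    case True
    then show ?thesis
      using Comp_inclusion_matrix(1) [OF i a, of "(fst i, 0)" "((1, b), 0)"]
      by (simp add: y_def multiset_category_unfold x_def singleton_matrix_def ab)
  next
    case False
    then show ?thesis
      using Comp_inclusion_matrix(2) [OF i a, of k "((1, b), 0)"]
      by (simp add: y_def multiset_category_unfold x_def)
  qed
  have "Comp A (projective b) M N f y ((1, b), 0) j =
      (\<Sum>k\<in>members M. if k = i then interval_Comp (1, b) (fst i) (fst j) (f i j) 1 else 0)"
    unfolding multiset_category_unfold multiset_Comp_def by (rule sum.cong) (auto simp: y1)
  also have "\<dots> = 1"
    using fD b by (auto simp: ab ij interval_Comp_eq nonzero_Hom_def)
  finally have "Comp A (projective b) M N f y \<noteq> 0" by auto
  with that [of b y] y b show thesis by auto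
qed

text \<open>
  For \<open>x\<close> of least degree \<open>t\<close> with \<open>f x \<noteq> 0\<close>, the restriction of \<open>f x\<close> to $[1,t-1]$ vanishes, so that
  \<open>f x\<close> factors through the quotient $[t,t]$ of $[1,t]$.
\<close>

lemma nonzero_on_socle:
  assumes ob: "M \<in> Ob A" "N \<in> Ob A" and f: "f \<in> Hom A M N" "f \<noteq> 0"
  obtains t x s where "1 \<le> t" "t \<le> int n" "x \<in> Hom A (projective t) M" "s \<in> Hom A (simple t) N" "s \<noteq> 0"
    "Comp A (projective t) M N f x = Comp A (projective t) (simple t) N s (arrow (1, t) (t, t))"
proof -
  define Q where "Q = (\<lambda>t. 1 \<le> int t \<and> int t \<le> int n \<and> (\<exists>x\<in>Hom A (projective (int t)) M. Comp A (projective (int t)) M N f x \<noteq> 0))"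
  have "\<exists>t. Q t"
  proof -
    obtain t x where "1 \<le> t" "t \<le> int n" "x \<in> Hom A (projective t) M" "Comp A (projective t) M N f x \<noteq> 0"
      using nonzero_on_projective [OF ob f] .
    then show ?thesis by (intro exI [of _ "nat t"]) (auto simp: Q_def)
  qed
  then have Q: "Q (LEAST t. Q t)" and min: "\<And>r. r < (LEAST t. Q t) \<Longrightarrow> \<not> Q r"
    by (auto intro: LeastI_ex dest: not_less_Least)
  define t where "t = int (LEAST t. Q t)"
  obtain x where t: "1 \<le> t" "t \<le> int n" and x: "x \<in> Hom A (projective t) M" and fx: "Comp A (projective t) M N f x \<noteq> 0"
    using Q by (auto simp: Q_def t_def)
  have 0: "Comp A {#(1, t - 1)#} (projective t) N (Comp A (projective t) M N f x) (arrow (1, t - 1) (1, t)) = 0" if "1 < t"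
  proof -
    define y where "y = Comp A (projective (t - 1)) (projective t) M x (arrow (1, t - 1) (1, t))"
    have ar: "arrow (1, t - 1) (1, t) \<in> Hom A (projective (t - 1)) (projective t)"
      unfolding projective_def using that by (intro arrow_in) simp
    have y: "y \<in> Hom A (projective (t - 1)) M"
      unfolding y_def using that t x ob ar by simp
    have "\<not> Q (nat (t - 1))" using that by (intro min) (auto simp: t_def)
    then have "Comp A (projective (t - 1)) M N f y = 0" using that t y by (auto simp: Q_def)
    moreover have "Comp A (projective (t - 1)) M N f y = Comp A (projective (t - 1)) (projective t) N (Comp A (projective t) M N f x) (arrow (1, t - 1) (1, t))"
      unfolding y_def using that t x ob f ar by (simp add: Comp_assoc)
    ultimately show ?thesis by (simp add: projective_def)
  qed
  have fx': "Comp A (projective t) M N f x \<in> Hom A (projective t) N" using t x ob f by simp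
  obtain s where s: "s \<in> Hom A (simple t) N" "Comp A (projective t) (simple t) N s (arrow (1, t) (t, t)) = Comp A (projective t) M N f x"
    using factor_through_quotient [of 1 t t "Comp A (projective t) M N f x" N] 0 t fx'
    by (auto simp: projective_def simple_def multiset_category_unfold)
  have "s \<noteq> 0"
  proof
    assume "s = 0"
    then have "Comp A (projective t) M N f x = 0"
      unfolding s(2) [symmetric] using t ob epic_projective_simple [of t] by (simp add: is_epic_def)
    with fx show False by simp
  qed
  with that t x s show thesis by metis
qed

section \<open>Counting elements\<close>

text \<open>
  An object with $k$ composition factors $[t,t]$ has $2^k$ elements of degree \<open>t\<close>.  Multiplying over
  all \<open>t\<close> gives a measure for inductions that also determines the length.
\<close>

lemma card_Hom_projective:
  "card (Hom A (projective t) {#(a, b)#}) = (if 1 \<le> a \<and> a \<le> t \<and> t \<le> b then 2 else 1)"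
  by (auto simp: projective_def Hom_singletons)

definition element_count :: "interval multiset \<Rightarrow> nat" where
  "element_count M = (\<Prod>t\<in>{1..int n}. card (Hom A (projective t) M))"

lemma element_count_pos: assumes "M \<in> Ob A" shows "element_count M > 0"
proof -
  have "card (Hom A (projective t) M) > 0" if "t \<in> {1..int n}" for t
    using that assms zero_multiset_Hom by (auto simp: multiset_category_unfold card_gt_0_iff finite_multiset_Hom)
  then show ?thesis by (auto simp: element_count_def intro!: prod_pos)
qed

lemma element_count_interval:
  assumes "(a, b) \<in> Ob (interval_category n)"
  shows "element_count {#(a, b)#} = 2 ^ nat (b - a + 1)"
proof -
  have "element_count {#(a, b)#} = (\<Prod>t\<in>{1..int n}. if t \<in> {a..b} then 2 else 1)"
    unfolding element_count_def card_Hom_projective using assms by (intro prod.cong) auto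
  also have "\<dots> = (\<Prod>t\<in>{1..int n} \<inter> {a..b}. 2)"
    by (rule prod.inter_restrict [symmetric]) simp
  also have "{1..int n} \<inter> {a..b} = {a..b}" using assms by auto
  finally show ?thesis by simp
qed

lemma element_count_simple: "\<lbrakk>1 \<le> t; t \<le> int n\<rbrakk> \<Longrightarrow> element_count (simple t) = 2"
  using element_count_interval [of t t] by (simp add: simple_def)

lemma element_count_exact:
  assumes "exact_cokernel A projectives M N f Q q" "is_monic A M N f" "M \<in> Ob A" "N \<in> Ob A"
  shows "element_count N = element_count M * element_count Q"
  unfolding element_count_def prod.distrib [symmetric]
  by (intro prod.cong refl card_Hom_exact [OF assms]) (auto simp: projectives_def)

lemma element_count_iso:
  assumes "is_iso A M N h" "M \<in> Ob A" "N \<in> Ob A"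
  shows "element_count M = element_count N"
  unfolding element_count_def by (intro prod.cong refl iso_card_Hom [OF assms]) auto

section \<open>Existence of cokernels, and monomorphisms as kernels\<close>

text \<open>
  For \<open>f \<noteq> 0\<close>, dividing \<open>N\<close> by the copy of \<open>simple t\<close> from \<open>nonzero_on_socle\<close> halves \<open>element_count N\<close>,
  and by \<open>exact_cokernel_extend\<close> it does not affect the cokernel of \<open>f\<close>.
\<close>

theorem exact_cokernel_exists:
  assumes "M \<in> Ob A" "N \<in> Ob A" "f \<in> Hom A M N"
  shows "\<exists>Q q. exact_cokernel A projectives M N f Q q"
  using assms
proof (induction "element_count N" arbitrary: N f rule: less_induct)
  case less
  show ?case
  proof (cases "f = 0")
    case True
    then show ?thesis using exact_cokernel_zero [OF less.prems(1,2) projectives_Ob] by blast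
  next
    case False
    obtain t x s where t: "1 \<le> t" "t \<le> int n" and x: "x \<in> Hom A (projective t) M"
      and s: "s \<in> Hom A (simple t) N" "s \<noteq> 0"
      and fx: "Comp A (projective t) M N f x = Comp A (projective t) (simple t) N s (arrow (1, t) (t, t))"
      using nonzero_on_socle [OF less.prems False] .
    have mono: "is_monic A (simple t) N s" using exact_cokernel_socle(1) [OF t less.prems(2) s] .
    obtain N' q where q: "exact_cokernel A projectives (simple t) N s N' q"
      using exact_cokernel_socle(2) [OF t less.prems(2) s] by blast
    note qD = exact_cokernelD [OF q]
    have "element_count N = 2 * element_count N'" using element_count_exact [OF q mono] t less.prems(2) by (simp add: element_count_simple)
    then have "element_count N' < element_count N" using element_count_pos [OF qD(2)] by simp
    then obtain Q q' where "exact_cokernel A projectives M N' (Comp A M N N' q f) Q q'"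
      using less.hyps [of N' "Comp A M N N' q f"] less.prems qD by auto
    then have "exact_cokernel A projectives M N f Q (Comp A N N' Q q' q)"
      by (intro exact_cokernel_extend [OF projectives_Ob _ _ _ _ _ s(1) q _ x epic_projective_simple [OF t] fx])
        (use less.prems t lift_to_projective in auto)
    then show ?thesis by blast
  qed
qed

text \<open>
  Direct sums reduce the claim to an interval $w = [a,b]$.  The element of degree \<open>b\<close> of \<open>N\<close> given by
  \<open>g\<close> is killed by \<open>q\<close>, so it comes from an element \<open>u\<close> of \<open>M\<close>.  Since \<open>m\<close> is monic, \<open>u\<close> vanishes in degree
  \<open>a - 1\<close> like the element given by \<open>g\<close>, and hence it comes from a morphism $[a,b] \to M$.
\<close>

lemma factor_through_monic:
  assumes ob: "M \<in> Ob A" "N \<in> Ob A" and m: "is_monic A M N m"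
    and q: "exact_cokernel A projectives M N m Q q"
    and w: "w \<in> Ob A" and g: "g \<in> Hom A w N" and qg: "Comp A w N Q q g = 0"
  shows "\<exists>h\<in>Hom A w M. Comp A w M N m h = g"
  using w g qg
proof (induction w arbitrary: g)
  case empty
  then have "g = 0" by simp
  have "m \<in> Hom A M N" using m by (simp add: is_monic_def)
  then have "Comp A {#} M N m 0 = 0" by (intro Comp_zero_right [OF _ ob]) simp_all
  moreover have "0 \<in> Hom A {#} M" by simp
  ultimately show ?case using \<open>g = 0\<close> by metis
next
  case (add x w)
  have mH: "m \<in> Hom A M N" using m by (simp add: is_monic_def)
  note qD = exact_cokernelD [OF q]
  obtain a b where x: "x = (a, b)" by (cases x)
  have ab: "1 \<le> a" "a \<le> b" "b \<le> int n" and w: "w \<in> Ob A" using add.prems(1) by (auto simp: x)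
  obtain i1 i2 p1 p2 where b: "biproduct A w {#x#} (add_mset x w) i1 i2 p1 p2"
    using biproduct_sum [of w n "{#x#}"] ab w by (auto simp: x)
  note bD [simp] = biproductD(1-7) [OF b]
  note [simp] = ob mH qD add.prems(2)
  define g1 g2 where "g1 = Comp A w (add_mset x w) N g i1" and "g2 = Comp A {#x#} (add_mset x w) N g i2"
  have gi: "Comp A v N Q q (Comp A v (add_mset x w) N g i) = 0" if "v \<in> Ob A" "i \<in> Hom A v (add_mset x w)" for v i
  proof -
    have "Comp A v N Q q (Comp A v (add_mset x w) N g i) = Comp A v (add_mset x w) Q (Comp A (add_mset x w) N Q q g) i"
      by (rule Comp_assoc [symmetric]) (use that bD(3) in \<open>simp_all del: Ob_multiset\<close>)
    also have "\<dots> = 0"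
      unfolding add.prems(3) by (rule Comp_zero_left) (use that bD(3) in \<open>simp_all del: Ob_multiset\<close>)
    finally show ?thesis .
  qed
  have g1: "g1 \<in> Hom A w N" "Comp A w N Q q g1 = 0"
    and g2: "g2 \<in> Hom A {#x#} N" "Comp A {#x#} N Q q g2 = 0"
    using gi by (simp_all add: g1_def g2_def del: Ob_multiset)
  obtain h1 where h1: "h1 \<in> Hom A w M" "Comp A w M N m h1 = g1"
    using add.IH [OF w g1] by blast
  obtain h2 where h2: "h2 \<in> Hom A {#x#} M" "Comp A {#x#} M N m h2 = g2"
  proof -
    have e: "is_epic A (projective b) {#x#} (arrow (1, b) (a, b))"
      using epic_arrow [of 1 b a] ab by (simp add: x projective_def)
    then have eH: "arrow (1, b) (a, b) \<in> Hom A (projective b) {#x#}" by (simp add: is_epic_def)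
    define v where "v = Comp A (projective b) {#x#} N g2 (arrow (1, b) (a, b))"
    have v: "v \<in> Hom A (projective b) N" using g2 ab eH by (simp add: v_def x)
    have "Comp A (projective b) N Q q v = Comp A (projective b) {#x#} Q (Comp A {#x#} N Q q g2) (arrow (1, b) (a, b))"
      unfolding v_def using g2 ab eH by (intro Comp_assoc [symmetric]) (auto simp: x)
    also have "\<dots> = 0" using g2(2) ab eH by (simp add: x)
    finally obtain u where u: "u \<in> Hom A (projective b) M" "Comp A (projective b) M N m u = v"
      using exact_cokernel_exact [OF q, of "projective b" v] v ab by (auto simp: projectives_def)
    have 0: "Comp A {#(1, a - 1)#} (projective b) M u (arrow (1, a - 1) (1, b)) = 0" if "1 < a"
    proof (rule monic_zeroD [OF m])
      have ar: "arrow (1, a - 1) (1, b) \<in> Hom A {#(1, a - 1)#} (projective b)"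
        unfolding projective_def using that ab by (intro arrow_in) simp
      show "Comp A {#(1, a - 1)#} (projective b) M u (arrow (1, a - 1) (1, b)) \<in> Hom A {#(1, a - 1)#} M"
        using ar u ab that by simp
      have "Comp A {#(1, a - 1)#} M N m (Comp A {#(1, a - 1)#} (projective b) M u (arrow (1, a - 1) (1, b))) =
          Comp A {#(1, a - 1)#} (projective b) N v (arrow (1, a - 1) (1, b))"
        unfolding u(2) [symmetric] using ar u(1) ab that by (intro Comp_assoc [symmetric]) simp_all
      also have "\<dots> = Comp A {#(1, a - 1)#} {#x#} N g2 (Comp A {#(1, a - 1)#} (projective b) {#x#} (arrow (1, b) (a, b)) (arrow (1, a - 1) (1, b)))"
        unfolding v_def using ar g2 eH ab that by (intro Comp_assoc) (auto simp: x)
      also have "Comp A {#(1, a - 1)#} (projective b) {#x#} (arrow (1, b) (a, b)) (arrow (1, a - 1) (1, b)) = 0"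
        unfolding projective_def x using ab that by (subst Comp_arrows) auto
      also have "Comp A {#(1, a - 1)#} {#x#} N g2 0 = 0"
        using g2(1) ab that by (intro Comp_zero_right) (simp_all add: x)
      finally show "Comp A {#(1, a - 1)#} M N m (Comp A {#(1, a - 1)#} (projective b) M u (arrow (1, a - 1) (1, b))) = 0" .
    qed (use ab that in auto)
    obtain u' where u': "u' \<in> Hom A {#x#} M" "Comp A (projective b) {#x#} M u' (arrow (1, b) (a, b)) = u"
      using factor_through_quotient [of 1 a b u M] u 0 ab by (auto simp: projective_def x multiset_category_unfold)
    have "Comp A {#x#} M N m u' = g2"
    proof (rule epicD [OF e])
      have "Comp A (projective b) {#x#} N (Comp A {#x#} M N m u') (arrow (1, b) (a, b)) = Comp A (projective b) M N m (Comp A (projective b) {#x#} M u' (arrow (1, b) (a, b)))"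
        using u' eH ab by (intro Comp_assoc) (auto simp: x)
      then show "Comp A (projective b) {#x#} N (Comp A {#x#} M N m u') (arrow (1, b) (a, b)) = Comp A (projective b) {#x#} N g2 (arrow (1, b) (a, b))"
        by (simp add: u' u v_def)
    qed (use u' g2 ab in \<open>auto simp: x\<close>)
    with u' that show thesis by blast
  qed
  define h where "h = Comp A (add_mset x w) w M h1 p1 + Comp A (add_mset x w) {#x#} M h2 p2"
  have "h \<in> Hom A (add_mset x w) M"
    unfolding h_def using h1 h2 by (simp del: Ob_multiset)
  moreover have "Comp A (add_mset x w) M N m h = g"
    unfolding h_def using h1 h2 biproduct_from [OF b, of N g]
    by (simp add: Comp_linear g1_def [symmetric] g2_def [symmetric] flip: Comp_assoc del: Ob_multiset)
  ultimately show ?case by blast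
qed

theorem monic_is_kernel:
  assumes ob: "M \<in> Ob A" "N \<in> Ob A" and m: "is_monic A M N m"
  shows "\<exists>Q\<in>Ob A. \<exists>q\<in>Hom A N Q. is_kernel A N Q q M m"
proof -
  have mH: "m \<in> Hom A M N" using m by (simp add: is_monic_def)
  obtain Q q where q: "exact_cokernel A projectives M N m Q q"
    using exact_cokernel_exists [OF ob mH] by blast
  have "is_kernel A N Q q M m"
    by (rule is_kernelI) (use ob m exact_cokernelD [OF q] factor_through_monic [OF ob m q] in auto)
  with exact_cokernelD [OF q] show ?thesis by blast
qed

section \<open>The category of multisets is abelian\<close>

text \<open>
  The reflection $[a,b] \mapsto [n+1-b,n+1-a]$ reverses the order of the inequalities
  $a \le c \le b \le d$, so it reverses the direction of morphisms.
\<close>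

definition reflect :: "interval \<Rightarrow> interval" where
  "reflect x = (int n + 1 - snd x, int n + 1 - fst x)"

definition reflect_index :: "interval \<times> nat \<Rightarrow> interval \<times> nat" where
  "reflect_index i = (reflect (fst i), snd i)"

definition dual_matrix :: "interval_matrix \<Rightarrow> interval_matrix" where
  "dual_matrix \<phi> = (\<lambda>i j. \<phi> (reflect_index j) (reflect_index i))"

lemma reflect_reflect [simp]: "reflect (reflect x) = x"
  by (simp add: reflect_def)

lemma reflect_index_reflect_index [simp]: "reflect_index (reflect_index i) = i"
  by (simp add: reflect_index_def)

lemma fst_reflect_index [simp]: "fst (reflect_index i) = reflect (fst i)"
  by (simp add: reflect_index_def)

lemma nonzero_Hom_reflect [simp]: "nonzero_Hom (reflect x) (reflect y) \<longleftrightarrow> nonzero_Hom y x"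
  by (auto simp: nonzero_Hom_def reflect_def)

lemma interval_Comp_reflect:
  "interval_Comp (reflect x) (reflect y) (reflect z) \<phi> \<psi> = interval_Comp z y x \<psi> \<phi>"
  by (auto simp: interval_Comp_eq reflect_def mult.commute)

lemma members_reflect: "i \<in> members (image_mset reflect M) \<longleftrightarrow> reflect_index i \<in> members M"
proof -
  have "reflect y = reflect x \<longleftrightarrow> y = x" for x y by (metis reflect_reflect)
  then have "count (image_mset reflect M) (reflect x) = count M x" for x
    by (induction M) auto
  from this [of "reflect (fst i)"] show ?thesis
    by (simp add: members_iff reflect_index_def)
qed

lemma dual_matrix_Comp:
  "dual_matrix (multiset_Comp M N Q g f) =
    multiset_Comp (image_mset reflect Q) (image_mset reflect N) (image_mset reflect M) (dual_matrix f) (dual_matrix g)"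
proof (intro ext)
  fix i k
  have "dual_matrix (multiset_Comp M N Q g f) i k =
    (\<Sum>j\<in>members N. interval_Comp (reflect (fst k)) (fst j) (reflect (fst i)) (g j (reflect_index i)) (f (reflect_index k) j))"
    by (simp add: dual_matrix_def multiset_Comp_def)
  also have "\<dots> = (\<Sum>j\<in>members (image_mset reflect N). interval_Comp (fst i) (fst j) (fst k)
      (f (reflect_index k) (reflect_index j)) (g (reflect_index j) (reflect_index i)))"
  proof (rule sum.reindex_bij_witness [of _ reflect_index reflect_index])
    fix j assume "j \<in> members N"
    show "interval_Comp (fst i) (fst (reflect_index j)) (fst k)
      (f (reflect_index k) (reflect_index (reflect_index j))) (g (reflect_index (reflect_index j)) (reflect_index i)) =
      interval_Comp (reflect (fst k)) (fst j) (reflect (fst i)) (g j (reflect_index i)) (f (reflect_index k) j)"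
      using interval_Comp_reflect [of "fst k" "reflect (fst j)" "fst i"] by simp
  qed (simp_all add: members_reflect)
  finally show "dual_matrix (multiset_Comp M N Q g f) i k =
    multiset_Comp (image_mset reflect Q) (image_mset reflect N) (image_mset reflect M) (dual_matrix f) (dual_matrix g) i k"
    by (simp add: dual_matrix_def multiset_Comp_def)
qed

lemma duality: "duality A (image_mset reflect) dual_matrix"
proof unfold_locales
  fix M N Q f g
  show "image_mset reflect M \<in> Ob A" if "M \<in> Ob A"
    using that by (fastforce simp: multiset_category_simps(1) Ob_interval_category reflect_def)
  have "reflect \<circ> reflect = id" by (auto simp: fun_eq_iff)
  then show "image_mset reflect (image_mset reflect M) = M"
    by (metis id_apply image_mset.comp image_mset.id comp_apply)
  show "dual_matrix f \<in> Hom A (image_mset reflect N) (image_mset reflect M)" if "f \<in> Hom A M N"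
  proof -
    have f: "f \<in> multiset_Hom M N" using that by (simp add: multiset_category_unfold)
    show ?thesis
      unfolding multiset_category_unfold multiset_Hom_iff
    proof (intro allI impI)
      fix i j assume "dual_matrix f i j = 1"
      then have "f (reflect_index j) (reflect_index i) = 1" by (simp add: dual_matrix_def)
      from multiset_HomD [OF f this] show "i \<in> members (image_mset reflect N) \<and>
          j \<in> members (image_mset reflect M) \<and> nonzero_Hom (fst i) (fst j)"
        by (simp add: members_reflect)
    qed
  qed
  show "dual_matrix (dual_matrix f) = f" by (simp add: dual_matrix_def)
  show "dual_matrix 0 = 0" by (simp add: dual_matrix_def fun_eq_iff)
  show "dual_matrix (Comp A M N Q g f) = Comp A (image_mset reflect Q) (image_mset reflect N) (image_mset reflect M)
    (dual_matrix f) (dual_matrix g)"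
    by (simp add: multiset_category_unfold dual_matrix_Comp)
qed

lemma zero_object_empty: "zero_object A {#}"
  unfolding zero_object_iff by (simp add: multiset_category_unfold multiset_Ident_def fun_eq_iff)

lemma direct_sum_sum: "\<lbrakk>M \<in> Ob A; N \<in> Ob A\<rbrakk> \<Longrightarrow> is_direct_sum A M N (M + N)"
  using biproduct_sum [of M n N] unfolding is_direct_sum_iff by blast

lemma not_zero_object_add: "\<not> zero_object A (add_mset x M)"
proof
  assume "zero_object A (add_mset x M)"
  then have "multiset_Ident (add_mset x M) (x, 0) (x, 0) = 0"
    by (simp add: zero_object_iff multiset_category_unfold)
  then show False by (simp add: multiset_Ident_def members_iff)
qed

theorem abelian: "abelian_category A"
proof -
  interpret dual: duality A "image_mset reflect" dual_matrix by (rule duality)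
  show ?thesis
  proof unfold_locales
    show "\<exists>z. zero_object A z" using zero_object_empty by blast
    fix x y f assume ob: "x \<in> Ob A" "y \<in> Ob A"
    show "\<exists>Z. is_direct_sum A x y Z" using direct_sum_sum [OF ob] by blast
    show "\<exists>Q q. is_cokernel A x y f Q q" if f: "f \<in> Hom A x y"
    proof -
      obtain Q q where "exact_cokernel A projectives x y f Q q"
        using exact_cokernel_exists [OF ob f] by blast
      then show ?thesis by (intro exI) (rule exact_cokernelD(1))
    qed
    show "\<exists>K k. is_kernel A x y f K k" if f: "f \<in> Hom A x y"
    proof -
      obtain Q q where "exact_cokernel A projectives (image_mset reflect y) (image_mset reflect x) (dual_matrix f) Q q"
        using exact_cokernel_exists [OF dual.D_Ob [OF ob(2)] dual.D_Ob [OF ob(1)] dual.T_Hom [OF f]] by blast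
      then show ?thesis by (intro exI) (rule dual.kernel_of_dual_cokernel [OF exact_cokernelD(1)])
    qed
    show "\<exists>z\<in>Ob A. \<exists>g\<in>Hom A y z. is_kernel A y z g x f" if "is_monic A x y f"
      using monic_is_kernel [OF ob that] .
    show "\<exists>w\<in>Ob A. \<exists>g\<in>Hom A w x. is_cokernel A w x g y f" if f: "is_epic A x y f"
    proof -
      obtain z g where z: "z \<in> Ob A" "g \<in> Hom A (image_mset reflect x) z"
        and g: "is_kernel A (image_mset reflect x) z g (image_mset reflect y) (dual_matrix f)"
        using monic_is_kernel [OF _ _ dual.monic_dual_of_epic [OF f]] ob dual.D_Ob by blast
      have "is_cokernel A (image_mset reflect z) x (dual_matrix g) y f"
        using dual.cokernel_of_dual_kernel [of x "image_mset reflect z" "dual_matrix g" "image_mset reflect y" "dual_matrix f"] g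
        by (simp only: dual.D_D dual.T_T)
      moreover have "dual_matrix g \<in> Hom A (image_mset reflect z) x"
        using dual.T_Hom [OF z(2)] by (simp only: dual.D_D)
      ultimately show ?thesis using dual.D_Ob [OF z(1)] by blast
    qed
  qed
qed

section \<open>Simple objects and composition length\<close>

lemma not_zero_object_simple: "\<not> zero_object A (simple t)"
  unfolding simple_def by (rule not_zero_object_add)

lemma ex_socle:
  assumes "M \<in> Ob A" "\<not> zero_object A M"
  obtains t s where "1 \<le> t" "t \<le> int n" "s \<in> Hom A (simple t) M" "s \<noteq> 0"
proof -
  have "Ident A M \<noteq> 0" using assms by (simp add: zero_object_iff)
  then show thesis
    using nonzero_on_socle [OF assms(1,1), of "Ident A M"] that assms(1) Ident_in_Hom by metis
qed

text \<open>
  A non-zero subobject of $[t,t]$ contains some $[r,r]$, and a non-zero morphism from $[r,r]$ to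
  $[t,t]$ is an identity.
\<close>

lemma simple_object_simple:
  assumes t: "1 \<le> t" "t \<le> int n"
  shows "simple_object A (simple t)"
  unfolding simple_object_def
proof (intro conjI ballI allI impI)
  fix y f assume y: "y \<in> Ob A" and f: "is_monic A y (simple t) f"
  have fH: "f \<in> Hom A y (simple t)" using f by (simp add: is_monic_def)
  show "zero_object A y \<or> is_iso A y (simple t) f"
  proof (cases "zero_object A y")
    case False
    then obtain r s where r: "1 \<le> r" "r \<le> int n" and s: "s \<in> Hom A (simple r) y" "s \<noteq> 0"
      using ex_socle y by metis
    have "Comp A (simple r) y (simple t) f s \<noteq> 0"
      using monic_zeroD [OF f, of "simple r" s] y t r s by auto
    moreover have "Comp A (simple r) y (simple t) f s \<in> Hom A (simple r) (simple t)"
      using y t r s fH by simp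
    ultimately have rt: "r = t" and fs: "Comp A (simple t) y (simple t) f s = Ident A (simple t)"
      by (auto simp: simple_def Hom_singletons arrow_refl split: if_splits)
    have "Comp A y (simple t) y s f = Ident A y"
    proof (rule monicD [OF f])
      have "Comp A y y (simple t) f (Comp A y (simple t) y s f) = Comp A y (simple t) (simple t) (Comp A (simple t) y (simple t) f s) f"
        using y t s fH rt by (intro Comp_assoc [symmetric]) auto
      then show "Comp A y y (simple t) f (Comp A y (simple t) y s f) = Comp A y y (simple t) f (Ident A y)"
        using y t fH by (simp add: fs)
    qed (use y t s fH rt in auto)
    with fs s rt fH show ?thesis unfolding is_iso_def by blast
  qed simp
qed (use t not_zero_object_simple in auto)

text \<open>
  Every non-zero object contains some $[t,t]$, so that a simple object is isomorphic to one of
  them.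
\<close>

lemma element_count_simple_object:
  assumes "simple_object A Q"
  shows "element_count Q = 2"
proof -
  have Q: "Q \<in> Ob A" "\<not> zero_object A Q" using assms by (auto simp: simple_object_def)
  obtain t s where t: "1 \<le> t" "t \<le> int n" and s: "s \<in> Hom A (simple t) Q" "s \<noteq> 0"
    using ex_socle [OF Q] .
  have "is_iso A (simple t) Q s"
    using assms exact_cokernel_socle(1) [OF t Q(1) s] not_zero_object_simple [of t] t Ob_simple [of t]
    unfolding simple_object_def by blast
  from element_count_iso [OF this] show ?thesis using t Q by (simp add: element_count_simple)
qed

lemma element_count_cokernel:
  assumes ob: "M \<in> Ob A" "N \<in> Ob A" and m: "is_monic A M N m" and q: "is_cokernel A M N m Q q"
  shows "element_count N = element_count M * element_count Q"
proof -
  have mH: "m \<in> Hom A M N" using m by (simp add: is_monic_def)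
  obtain Q' q' where q': "exact_cokernel A projectives M N m Q' q'"
    using exact_cokernel_exists [OF ob mH] by blast
  obtain h where "is_iso A Q Q' h"
    using cokernel_unique [OF q exact_cokernelD(1) [OF q'] ob mH] by blast
  moreover have "Q \<in> Ob A" using q by (simp add: is_cokernel_def)
  ultimately show ?thesis
    using element_count_exact [OF q' m ob] element_count_iso exact_cokernelD(2) [OF q'] by simp
qed

lemma element_count_composition_series:
  assumes "composition_series A M k X m"
  shows "element_count M = 2 ^ k"
proof -
  have "element_count (X i) = 2 ^ i" if "i \<le> k" for i
    using that
  proof (induction i)
    case 0
    have "card (Hom A (projective t) (X 0)) = 1" if "t \<in> {1..int n}" for t
    proof -
      have "\<exists>!f. f \<in> Hom A (projective t) (X 0)"
        using assms that by (auto simp: composition_series_def zero_object_def)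
      then show ?thesis by (metis card_1_singleton_iff is_singletonI' is_singleton_def One_nat_def empty_iff)
    qed
    then show ?case by (simp add: element_count_def)
  next
    case (Suc i)
    then have "X i \<in> Ob A" "X (Suc i) \<in> Ob A" "is_monic A (X i) (X (Suc i)) (m i)"
      and "\<exists>Q q. is_cokernel A (X i) (X (Suc i)) (m i) Q q \<and> simple_object A Q"
      using assms by (auto simp: composition_series_def)
    then show ?case using element_count_cokernel element_count_simple_object Suc by fastforce
  qed
  then show ?thesis using assms by (auto simp: composition_series_def)
qed

text \<open>
  A non-empty multiset maps onto some $[b,b]$; the kernel of this epimorphism has fewer elements.
\<close>

theorem ex_composition_series: "M \<in> Ob A \<Longrightarrow> \<exists>k X m. composition_series A M k X m"
proof (induction "element_count M" arbitrary: M rule: less_induct)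
  case less
  interpret abelian_category A by (rule abelian)
  show ?case
  proof (cases M)
    case empty
    then have "composition_series A M 0 (\<lambda>_. {#}) (\<lambda>_. 0)"
      using zero_object_empty by (simp add: composition_series_def)
    then show ?thesis by blast
  next
    case (add x N)
    obtain a b where x: "x = (a, b)" by (cases x)
    have ab: "1 \<le> a" "a \<le> b" "b \<le> int n" and N: "N \<in> Ob A"
      using less.prems by (auto simp: add x)
    obtain i1 i2 p1 p2 where b: "biproduct A N {#x#} M i1 i2 p1 p2"
      using biproduct_sum [of N n "{#x#}"] ab N by (auto simp: x add)
    define p where "p = Comp A M {#x#} (simple b) (arrow (a, b) (b, b)) p2"
    have p: "is_epic A M (simple b) p"
      unfolding p_def
      by (rule epic_Comp [OF biproduct_p2_epic [OF b]])
        (use epic_arrow [of a b b] ab less.prems in \<open>auto simp: x simple_def\<close>)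
    then have pH: "p \<in> Hom A M (simple b)" by (simp add: is_epic_def)
    have Sb: "simple b \<in> Ob A" using ab by simp
    obtain K k where k: "is_kernel A M (simple b) p K k"
      using ex_kernel [OF less.prems Sb pH] by blast
    have K: "K \<in> Ob A" using k by (simp add: is_kernel_def)
    have mono: "is_monic A K M k" by (rule kernel_monic [OF k less.prems Sb pH])
    obtain w g where "w \<in> Ob A" "g \<in> Hom A w M" "is_cokernel A w M g (simple b) p"
      using epic_is_cokernel [OF less.prems Sb p] by blast
    then have coker: "is_cokernel A K M k (simple b) p"
      using epic_is_cokernel_of_kernel k less.prems Sb by blast
    have "element_count M = element_count K * 2"
      using element_count_cokernel [OF K less.prems mono coker] ab by (simp add: element_count_simple)
    then have "element_count K < element_count M" using element_count_pos [OF K] by simp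
    then obtain l X m where "composition_series A K l X m"
      using less.hyps K by blast
    then have "composition_series A M (Suc l) (X(Suc l := M)) (m(l := k))"
      using less.prems mono coker simple_object_simple ab by (intro composition_series_extend) auto
    then show ?thesis by blast
  qed
qed

theorem composition_length_interval:
  assumes ab: "(a, b) \<in> Ob (interval_category n)" and l: "b - a = int l"
  shows "has_composition_length A {#(a, b)#} (l + 1)"
proof -
  have ob: "{#(a, b)#} \<in> Ob A" using ab by simp
  have "element_count {#(a, b)#} = 2 ^ (l + 1)"
    using element_count_interval [OF ab] l by (simp add: nat_add_distrib)
  then have "k = l + 1" if "composition_series A {#(a, b)#} k X m" for k X m
    using element_count_composition_series [OF that] power_inject_exp [of "2 :: nat" "l + 1" k] by simp
  then show ?thesis
    unfolding has_composition_length_def using ex_composition_series [OF ob] by metis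
qed

section \<open>Indecomposable objects\<close>

theorem indecomposable_iff: "indecomposable A M \<longleftrightarrow> (\<exists>x\<in>Ob (interval_category n). M = {#x#})"
proof
  assume M: "indecomposable A M"
  then have ob: "M \<in> Ob A" and nz: "\<not> zero_object A M" by (auto simp: indecomposable_def)
  obtain x N where N: "M = add_mset x N"
    using nz zero_object_empty by (cases M) auto
  then have "is_direct_sum A {#x#} N M" using ob direct_sum_sum [of "{#x#}" N] by simp
  then have "zero_object A N"
    using M not_zero_object_add [of x "{#}"] unfolding indecomposable_def by blast
  then have "N = {#}" using not_zero_object_add by (cases N) auto
  with N ob show "\<exists>x\<in>Ob (interval_category n). M = {#x#}" by simp
next
  assume "\<exists>x\<in>Ob (interval_category n). M = {#x#}"
  then obtain x where "x \<in> Ob (interval_category n)" "M = {#x#}" ..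
  then show "indecomposable A M"
    by (auto intro!: indecomposable_if_local_End simp: not_zero_object_add Hom_singletons arrow_refl split: if_splits)
qed

end

lemma full_subcategory_simps [simp]:
  "Ob (full_subcategory C Q) = {x \<in> Ob C. Q x}"
  "Hom (full_subcategory C Q) = Hom C"
  "Ident (full_subcategory C Q) = Ident C"
  "Comp (full_subcategory C Q) = Comp C"
  by (simp_all add: full_subcategory_def)

lemma linear_full_subcategory:
  assumes "linear_category C s"
  shows "linear_category (full_subcategory C Q) s"
proof -
  interpret linear_category C s by fact
  show ?thesis
    by unfold_locales
      (simp_all add: Comp_assoc Comp_add_left Comp_add_right scale_in_Hom Comp_scale_left Comp_scale_right)
qed

lemma linear_isomorphism:
  "linear_category_isomorphism (interval_category n) (*)
     (full_subcategory (multiset_category n) (indecomposable (multiset_category n))) matrix_scale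
     (\<lambda>x. {#x#}) singleton_matrix"
proof -
  interpret interval_multisets n .
  show ?thesis
  proof (intro linear_category_isomorphism.intro linear_category_isomorphism_axioms.intro
      linear_interval_category linear_full_subcategory linear_multiset_category)
    show "bij_betw (\<lambda>x. {#x#}) (Ob (interval_category n)) (Ob (full_subcategory A (indecomposable A)))"
      by (auto simp: bij_betw_def inj_on_def indecomposable_iff)
  next
    fix x y
    have UNIV: "(UNIV :: bit set) = {0, 1}" by (auto intro: bit.exhaust)
    have inj: "inj (singleton_matrix x y)"
      by (auto simp: inj_on_def singleton_matrix_def fun_eq_iff split: if_splits)
    have 0: "singleton_matrix x y 0 = 0" by (auto simp: singleton_matrix_def fun_eq_iff)
    show "bij_betw (singleton_matrix x y) (Hom (interval_category n) x y)
        (Hom (full_subcategory A (indecomposable A)) {#x#} {#y#})"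
      using inj_on_subset [OF inj] by (auto simp: bij_betw_def interval_Hom_eq Hom_singletons UNIV 0)
  next
    fix x y z f g
    show "singleton_matrix x y (f + g) = singleton_matrix x y f + singleton_matrix x y g"
      by (auto simp: singleton_matrix_def fun_eq_iff)
    show "singleton_matrix x y (c * f) = matrix_scale c (singleton_matrix x y f)" for c
      by (auto simp: singleton_matrix_def matrix_scale_def fun_eq_iff)
    show "singleton_matrix x x (Ident (interval_category n) x) = Ident (full_subcategory A (indecomposable A)) {#x#}"
      by (simp add: arrow_refl)
    show "singleton_matrix x z (Comp (interval_category n) x y z g f) =
        Comp (full_subcategory A (indecomposable A)) {#x#} {#y#} {#z#} (singleton_matrix y z g) (singleton_matrix x y f)"
      by (auto simp: multiset_category_unfold multiset_Comp_def singleton_matrix_def fun_eq_iff)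
  qed
qed

theorem lemma3:
  fixes n :: nat
  assumes "n \<ge> 1"
  shows
    "linear_category (multiset_category n) matrix_scale \<and>
     abelian_category (multiset_category n) \<and>
     zero_object (multiset_category n) {#} \<and>
     (\<forall>M \<in> Ob (multiset_category n). \<forall>N \<in> Ob (multiset_category n).
        is_direct_sum (multiset_category n) M N (M + N)) \<and>
     linear_category_isomorphism
       (interval_category n) (*)
       (full_subcategory (multiset_category n) (indecomposable (multiset_category n))) matrix_scale
       (\<lambda>x. {#x#}) singleton_matrix \<and>
     (\<forall>M \<in> Ob (multiset_category n). \<exists>k X m. composition_series (multiset_category n) M k X m) \<and>
     (\<forall>a b l. (a, b) \<in> Ob (interval_category n) \<and> b - a = int l \<longrightarrow>
        has_composition_length (multiset_category n) {#(a, b)#} (l + 1))"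
proof -
  interpret interval_multisets n .
  show ?thesis
    using linear_multiset_category abelian zero_object_empty direct_sum_sum linear_isomorphism
      ex_composition_series composition_length_interval
    by blast
qed

end
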